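(* Let $G$ be an outerplanar graph and let $\mathcal H,\mathcal K$ be two non-piercing families of subgraphs of $G$. Then $(G,\mathcal H,\mathcal K)$ admits an intersection support that is an outerplanar graph.
   Context: All graphs are finite and simple. A subgraph $H$ of a graph $G$ is identified with its vertex set $V(H)$ (subgraphs are taken to be induced), and intersections, differences and containments of subgraphs refer to their vertex sets. A family $\mathcal H$ of subgraphs of $G$ is non-piercing if every $H\in\mathcal H$ induces a connected subgraph of $G$ and, for all $H,H'\in\mathcal H$, the induced subgraph $G[V(H)\setminus V(H')]$ is connected (an empty vertex set is regarded as connected). For families $\mathcal H,\mathcal K$ of subgraphs of $G$ and $K\in\mathcal K$, let $\mathcal H_K=\{H\in\mathcal H: V(H)\cap V(K)\ne\emptyset\}$. An intersection support for $(G,\mathcal H,\mathcal K)$ is a graph $\tilde Q$ with vertex set $\mathcal H$ such that $\tilde Q[\mathcal H_K]$ is connected for every $K\in\mathcal K$. A graph is outerplanar if it has a plane embedding with all vertices on the outer face. *)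

theory Defs
  imports "HOL-Analysis.Analysis"
begin

definition simple_graph :: "'a set \<Rightarrow> ('a \<Rightarrow> 'a \<Rightarrow> bool) \<Rightarrow> bool" where
  "simple_graph V E \<longleftrightarrow> finite V \<and> (\<forall>u v. E u v \<longrightarrow> u \<in> V \<and> v \<in> V)
     \<and> (\<forall>u v. E u v \<longrightarrow> E v u) \<and> (\<forall>u. \<not> E u u)"

(* The induced subgraph on S is connected (empty S counts as connected). *)
definition connected_on :: "('a \<Rightarrow> 'a \<Rightarrow> bool) \<Rightarrow> 'a set \<Rightarrow> bool" where
  "connected_on E S \<longleftrightarrow>
     (\<forall>x\<in>S. \<forall>y\<in>S. (\<lambda>u v. u \<in> S \<and> v \<in> S \<and> E u v)\<^sup>*\<^sup>* x y)"

definition plane_embedding ::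
  "'a set \<Rightarrow> ('a \<Rightarrow> 'a \<Rightarrow> bool) \<Rightarrow> ('a \<Rightarrow> complex) \<Rightarrow> ('a \<Rightarrow> 'a \<Rightarrow> real \<Rightarrow> complex) \<Rightarrow> bool" where
  "plane_embedding V E pos \<gamma> \<longleftrightarrow>
     inj_on pos V \<and>
     (\<forall>u v. E u v \<longrightarrow> arc (\<gamma> u v) \<and> pathstart (\<gamma> u v) = pos u \<and> pathfinish (\<gamma> u v) = pos v
            \<and> \<gamma> v u = reversepath (\<gamma> u v)
            \<and> path_image (\<gamma> u v) \<inter> pos ` V \<subseteq> {pos u, pos v}) \<and>
     (\<forall>u v x y. E u v \<longrightarrow> E x y \<longrightarrow> {u, v} \<noteq> {x, y} \<longrightarrow>
            path_image (\<gamma> u v) \<inter> path_image (\<gamma> x y) \<subseteq> pos ` ({u, v} \<inter> {x, y}))"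

definition drawing :: "'a set \<Rightarrow> ('a \<Rightarrow> 'a \<Rightarrow> bool) \<Rightarrow> ('a \<Rightarrow> complex) \<Rightarrow> ('a \<Rightarrow> 'a \<Rightarrow> real \<Rightarrow> complex) \<Rightarrow> complex set" where
  "drawing V E pos \<gamma> = pos ` V \<union> (\<Union>{path_image (\<gamma> u v) | u v. E u v})"

definition outerplanar :: "'a set \<Rightarrow> ('a \<Rightarrow> 'a \<Rightarrow> bool) \<Rightarrow> bool" where
  "outerplanar V E \<longleftrightarrow> (\<exists>pos \<gamma>. plane_embedding V E pos \<gamma> \<and>
     (\<exists>F \<in> components (- drawing V E pos \<gamma>). \<not> bounded F \<and> (\<forall>v\<in>V. pos v \<in> frontier F)))"

(* Non-piercing family of subgraphs (identified with vertex sets) of G = (V,E). *)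
definition non_piercing :: "'a set \<Rightarrow> ('a \<Rightarrow> 'a \<Rightarrow> bool) \<Rightarrow> 'a set set \<Rightarrow> bool" where
  "non_piercing V E \<H> \<longleftrightarrow> (\<forall>H\<in>\<H>. H \<subseteq> V \<and> connected_on E H) \<and>
     (\<forall>H\<in>\<H>. \<forall>H'\<in>\<H>. connected_on E (H - H'))"

definition intersection_support ::
  "'a set set \<Rightarrow> 'a set set \<Rightarrow> ('a set \<Rightarrow> 'a set \<Rightarrow> bool) \<Rightarrow> bool" where
  "intersection_support \<H> \<K> Q \<longleftrightarrow> simple_graph \<H> Q \<and>
     (\<forall>K\<in>\<K>. connected_on Q {H \<in> \<H>. H \<inter> K \<noteq> {}})"

end

theory Submission
  imports Defs
begin

text \<open>
  A drawing with all vertices on the outer face contains no theta graph whose three paths all have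
  inner vertices (by Janiszewski's theorem one of the three arcs of a theta curve lies inside the
  other two) and no two crossing chords of a cycle. Hence blocks are Hamiltonian and the vertices can
  be numbered so that no two edges cross; then disjoint connected vertex sets do not interleave.

  So for members of a non-piercing family, H - H' and H' never interleave, and an H disjoint from K
  does not interleave with K. Order the sets H by their minimum, breaking ties by letting the set that
  contains the first point of difference come last. In this order the traces of the sets K are
  ABAB-free: they admit no H1 < H2 < H3 < H4 with H1, H3 met only by K and H2, H4 met only by K'.
  An ABAB-free family on a linear order has a noncrossing support, built like a Delaunay
  triangulation of a convex polygon from chords that no member of the family has to cross.
  Placing the vertices of such a support on a parabola gives an outerplanar drawing.
\<close>

section \<open>Noncrossing supports of ABAB-free families\<close>

text \<open>The drawing serves only to produce a numbering of the vertices; everything after that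
  concerns finite sets of natural numbers. Of the outer face one consequence is used: it is
  connected, unbounded and misses the drawing, so no vertex lies inside a closed curve made of
  edges. Of a non-piercing family one consequence is used: \<open>H\<close> and
  \<open>H' - H\<close> are disjoint and connected.

  The obstacle is that interleaving is a cyclic notion, whereas the sets have to be put into a
  linear order. Comparing minima cuts the circle before the first vertex. For sets with the same
  minimum, non-interleaving forces the points private to one of them to precede the points private
  to the other, and the tie-break fixes which of the two counts as later.

  A set that meets both \<open>K\<close> and \<open>K'\<close> belongs to both traces and cannot
  obstruct either, which is why ABAB patterns are excluded only between the differences of two
  traces. The support is then a triangulation: each triangle is chosen so that a trace split by it
  and missing its apex contains both ends of its base.\<close>

lemma connected_on_mono:
  assumes "connected_on E S" "\<And>x y. x \<in> S \<Longrightarrow> y \<in> S \<Longrightarrow> E x y \<Longrightarrow> E' x y"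
  shows "connected_on E' S"
  unfolding connected_on_def
proof (intro ballI)
  fix x y assume "x \<in> S" "y \<in> S"
  with assms(1) have "(\<lambda>u v. u \<in> S \<and> v \<in> S \<and> E u v)\<^sup>*\<^sup>* x y"
    by (simp add: connected_on_def)
  then show "(\<lambda>u v. u \<in> S \<and> v \<in> S \<and> E' u v)\<^sup>*\<^sup>* x y"
    by (rule rtranclp_mono[THEN predicate2D, rotated]) (use assms(2) in auto)
qed

lemma connected_on_Un:
  assumes S: "connected_on E S" and T: "connected_on E T"
    and x: "x \<in> S" and y: "y \<in> T" and xy: "x = y \<or> (E x y \<and> E y x)"
  shows "connected_on E (S \<union> T)"
proof -
  let ?R = "\<lambda>u v. u \<in> S \<union> T \<and> v \<in> S \<union> T \<and> E u v"
  have 1: "?R\<^sup>*\<^sup>* u v" if "u \<in> S" "v \<in> S" for u v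
    by (rule rtranclp_mono[THEN predicate2D, of "\<lambda>u v. u \<in> S \<and> v \<in> S \<and> E u v"])
       (use S that in \<open>auto simp: connected_on_def\<close>)
  have 2: "?R\<^sup>*\<^sup>* u v" if "u \<in> T" "v \<in> T" for u v
    by (rule rtranclp_mono[THEN predicate2D, of "\<lambda>u v. u \<in> T \<and> v \<in> T \<and> E u v"])
       (use T that in \<open>auto simp: connected_on_def\<close>)
  have 3: "?R\<^sup>*\<^sup>* x y" "?R\<^sup>*\<^sup>* y x"
    using x y xy by (auto intro: r_into_rtranclp)
  show ?thesis
    unfolding connected_on_def
  proof (intro ballI)
    fix u v assume "u \<in> S \<union> T" "v \<in> S \<union> T"
    then show "?R\<^sup>*\<^sup>* u v"
      using 1[of u v] 2[of u v] 1[of u x] 2[of y v] 2[of u y] 1[of x v] 3 x y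
      by (auto intro: rtranclp_trans)
  qed
qed

lemma connected_on_crossing_edge:
  assumes "connected_on E S" "x \<in> S" "P x" "y \<in> S" "\<not> P y"
  obtains u v where "u \<in> S" "v \<in> S" "E u v" "P u" "\<not> P v"
proof -
  have "(\<lambda>u v. u \<in> S \<and> v \<in> S \<and> E u v)\<^sup>*\<^sup>* x y"
    using assms by (auto simp: connected_on_def)
  then have "P x \<longrightarrow> \<not> P y \<longrightarrow> (\<exists>u v. u \<in> S \<and> v \<in> S \<and> E u v \<and> P u \<and> \<not> P v)"
    by induction blast+
  then show ?thesis using that assms by blast
qed

section \<open>ABAB patterns and chords of a convex polygon\<close>

definition abab :: "nat set \<Rightarrow> nat set \<Rightarrow> bool" where
  "abab S T \<longleftrightarrow> (\<exists>a\<in>S. \<exists>b\<in>T. \<exists>c\<in>S. \<exists>d\<in>T. a < b \<and> b < c \<and> c < d)"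

lemma ababI: "a \<in> S \<Longrightarrow> b \<in> T \<Longrightarrow> c \<in> S \<Longrightarrow> d \<in> T \<Longrightarrow> a < b \<Longrightarrow> b < c \<Longrightarrow> c < d \<Longrightarrow> abab S T"
  unfolding abab_def by blast

definition noncrossing :: "(nat \<Rightarrow> nat \<Rightarrow> bool) \<Rightarrow> bool" where
  "noncrossing T \<longleftrightarrow> (\<forall>a b c d. a < b \<longrightarrow> b < c \<longrightarrow> c < d \<longrightarrow> \<not> (T a c \<and> T b d))"

text \<open>Here a, ..., b are the vertices of a convex polygon; A blocks the chord from c to d if A misses
  c and d but has points of the polygon on both sides of the chord.\<close>

definition unblocked :: "nat set set \<Rightarrow> nat \<Rightarrow> nat \<Rightarrow> nat \<Rightarrow> nat \<Rightarrow> bool" where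
  "unblocked \<A> a b c d \<longleftrightarrow> (\<forall>A\<in>\<A>. c \<in> A \<or> d \<in> A \<or>
      (\<forall>x\<in>A. \<not> (c < x \<and> x < d)) \<or> (\<forall>x\<in>A. \<not> (a \<le> x \<and> x < c \<or> d < x \<and> x \<le> b)))"

lemma unblockedD:
  assumes "unblocked \<A> a b c d" "A \<in> \<A>" "c \<notin> A" "d \<notin> A" "x \<in> A" "c < x" "x < d"
    "y \<in> A" "a \<le> y \<and> y < c \<or> d < y \<and> y \<le> b"
  shows False
  using assms unfolding unblocked_def by blast

lemma unblockedI:
  assumes "\<And>A x y. A \<in> \<A> \<Longrightarrow> c \<notin> A \<Longrightarrow> d \<notin> A \<Longrightarrow> x \<in> A \<Longrightarrow> c < x \<Longrightarrow> x < d \<Longrightarrow>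
    y \<in> A \<Longrightarrow> a \<le> y \<and> y < c \<or> d < y \<and> y \<le> b \<Longrightarrow> False"
  shows "unblocked \<A> a b c d"
  using assms unfolding unblocked_def by blast

text \<open>Chords found inside the subpolygon cut off by an unblocked chord stay unblocked in the
  large polygon. A set blocking the inner chord has no point of the subpolygon on or beyond its
  ends, so it also misses \<open>c\<close> and \<open>d\<close> and already blocks the outer
  chord.\<close>

lemma unblocked_trans:
  assumes 1: "unblocked \<A> a b c d" and 2: "unblocked \<A> c d c' d'" and "c \<le> c'" "d' \<le> d"
  shows "unblocked \<A> a b c' d'"
proof (rule unblockedI)
  fix A x y
  assume A: "A \<in> \<A>" "c' \<notin> A" "d' \<notin> A" "x \<in> A" "c' < x" "x < d'"
    "y \<in> A" "a \<le> y \<and> y < c' \<or> d' < y \<and> y \<le> b"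
  have *: "\<not> (c \<le> z \<and> z < c' \<or> d' < z \<and> z \<le> d)" if "z \<in> A" for z
    using unblockedD[OF 2 A(1-6) that] by blast
  have "c \<notin> A"
  proof
    assume "c \<in> A" with *[of c] A assms(3,4) show False by (cases "c = c'") auto
  qed
  moreover have "d \<notin> A"
  proof
    assume "d \<in> A" with *[of d] A assms(3,4) show False by (cases "d = d'") auto
  qed
  moreover have "c < x" "x < d" using A assms(3,4) by auto
  moreover have "a \<le> y \<and> y < c \<or> d < y \<and> y \<le> b"
    using *[OF A(7)] A(8) assms(3,4) by auto
  ultimately show False using unblockedD[OF 1 A(1)] A by blast
qed

text \<open>The apex is the third corner of the Delaunay triangle over the base from
  \<open>a\<close> to \<open>b\<close>. The candidate is the farthest \<open>v\<close> with an
  unblocked chord to \<open>a\<close>; there is one, because the chord to \<open>a + 1\<close> has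
  no points on its inner side.\<close>

lemma unblocked_apex:
  assumes free: "\<And>A B. A \<in> \<A> \<Longrightarrow> B \<in> \<A> \<Longrightarrow> \<not> abab (A - B) (B - A)"
    and "a + 2 \<le> b"
  shows "\<exists>v. a < v \<and> v < b \<and> unblocked \<A> a b a v \<and> unblocked \<A> a b v b"
  using assms(2)
proof (induction "b - a" arbitrary: a b rule: less_induct)
  case less
  let ?G = "{v. a < v \<and> v < b \<and> unblocked \<A> a b a v}"
  have "a + 1 \<in> ?G" using less.prems by (auto simp: unblocked_def)
  moreover have fin: "finite ?G" by (rule finite_subset[of _ "{..b}"]) auto
  ultimately have "Max ?G \<in> ?G" by (intro Max_in) auto
  define v where "v = Max ?G"
  have v: "a < v" "v < b" "unblocked \<A> a b a v"
    using \<open>Max ?G \<in> ?G\<close> unfolding v_def by auto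
  have vmax: "w \<le> v" if "a < w" "w < b" "unblocked \<A> a b a w" for w
    unfolding v_def using fin that by (intro Max_ge) auto
  \<comment> \<open>If A blocked the chord from v to b, then A contains a, and in the smallest unblocked chord of
    [v, b] enclosing the rest of A the apex w lies in A; the chord from a to w is then unblocked too,
    against the maximality of v.\<close>
  have "unblocked \<A> a b v b"
  proof (rule unblockedI)
    fix A x y
    assume A: "A \<in> \<A>" "v \<notin> A" "b \<notin> A" "x \<in> A" "v < x" "x < b" "y \<in> A"
      "a \<le> y \<and> y < v \<or> b < y \<and> y \<le> b"
    have aA: "a \<in> A"
    proof (rule ccontr)
      assume "a \<notin> A"
      with unblockedD[OF v(3) A(1) this A(2) A(7)] A show False
        by (metis le_less leD less_le_trans)
    qed
    let ?P = "\<lambda>n. \<exists>q p. n = p - q \<and> v \<le> q \<and> q < p \<and> p \<le> b \<and> unblocked \<A> v b q p \<and>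
      (\<forall>z\<in>A. v \<le> z \<and> z \<le> b \<longrightarrow> q < z \<and> z < p)"
    have "v < z \<and> z < b" if "z \<in> A" "v \<le> z" "z \<le> b" for z
      using that A(2,3) by (cases "z = v"; cases "z = b") auto
    moreover have "unblocked \<A> v b v b" by (auto simp: unblocked_def)
    ultimately have "?P (b - v)"
      using v by blast
    then have "?P (LEAST n. ?P n)" by (rule LeastI)
    then obtain q p where qp: "p - q = (LEAST n. ?P n)" "v \<le> q" "q < p" "p \<le> b" "unblocked \<A> v b q p"
      and "\<forall>z\<in>A. v \<le> z \<and> z \<le> b \<longrightarrow> q < z \<and> z < p"
      by (elim exE conjE) (rule that, erule sym, assumption+)
    then have Aqp: "\<And>z. z \<in> A \<Longrightarrow> v \<le> z \<Longrightarrow> z \<le> b \<Longrightarrow> q < z \<and> z < p"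
      by blast
    have least: "p - q \<le> p' - q'" if "v \<le> q'" "q' < p'" "p' \<le> b" "unblocked \<A> v b q' p'"
      "\<And>z. z \<in> A \<Longrightarrow> v \<le> z \<Longrightarrow> z \<le> b \<Longrightarrow> q' < z \<and> z < p'" for q' p'
      unfolding qp(1) by (rule Least_le) (use that in blast)
    have "q < x" "x < p" using Aqp[of x] A by auto
    then have "q + 2 \<le> p" "p - q < b - a" using qp v by auto
    from less.hyps[OF this(2,1)] obtain w where w: "q < w" "w < p"
      "unblocked \<A> q p q w" "unblocked \<A> q p w p" by blast
    have uqw: "unblocked \<A> v b q w" and uwp: "unblocked \<A> v b w p"
      using unblocked_trans[OF qp(5) w(3)] unblocked_trans[OF qp(5) w(4)] w by auto
    have qA: "q \<notin> A" "p \<notin> A" using Aqp[of q] Aqp[of p] qp v by auto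
    \<comment> \<open>Otherwise \<open>A\<close>, which blocks neither chord at \<open>w\<close>,
      has all its points of [v, b] on one side of \<open>w\<close>, and the chord on that side is a
      shorter one enclosing them.\<close>
    have wA: "w \<in> A"
    proof (rule ccontr)
      assume wA: "w \<notin> A"
      show False
      proof (cases "x < w")
        case True
        have "p - q \<le> w - q"
        proof (rule least)
          fix z assume z: "z \<in> A" "v \<le> z" "z \<le> b"
          show "q < z \<and> z < w"
            using unblockedD[OF uqw A(1) qA(1) wA A(4) \<open>q < x\<close> True z(1)] z Aqp[OF z] wA
            by (metis linorder_neqE_nat)
        qed (use w qp uqw in auto)
        then show False using w by auto
      next
        case False
        then have "w < x" using wA A by (metis linorder_neqE_nat)
        have "p - q \<le> p - w"
        proof (rule least)
          fix z assume z: "z \<in> A" "v \<le> z" "z \<le> b"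
          show "w < z \<and> z < p"
            using unblockedD[OF uwp A(1) wA qA(2) A(4) \<open>w < x\<close> \<open>x < p\<close> z(1)] z Aqp[OF z] wA
            by (metis linorder_neqE_nat)
        qed (use w qp uwp in auto)
        then show False using w by auto
      qed
    qed
    have "unblocked \<A> a b a w"
    proof (rule unblockedI)
      fix B s t
      assume B: "B \<in> \<A>" "a \<notin> B" "w \<notin> B" "s \<in> B" "a < s" "s < w" "t \<in> B"
        "a \<le> t \<and> t < a \<or> w < t \<and> t \<le> b"
      then have t: "w < t" "t \<le> b" by auto
      have av: "False" if "v \<notin> B" "r \<in> B" "a < r" "r < v" for r
        using unblockedD[OF v(3) B(1,2) that B(7)] t w qp by auto
      \<comment> \<open>The part of \<open>A\<close> in [v, b] lies strictly below \<open>p\<close>,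
        so \<open>p\<close> itself, or \<open>t\<close> if it is not below \<open>p\<close>, can be
        taken when it is in \<open>B\<close>. Otherwise the chord from \<open>w\<close> to
        \<open>p\<close> keeps \<open>B\<close> out of [v, w); then \<open>s < v\<close>, and
        \<open>B\<close> would block the chord from \<open>a\<close> to \<open>v\<close>.\<close>
      obtain t' where t': "t' \<in> B - A" "w < t'"
      proof (cases "t < p \<and> p \<notin> B")
        case False
        with B t Aqp[of t] Aqp[of p] w qp that[of t] that[of p] show ?thesis by force
      next
        case True
        have *: "\<not> (v \<le> z \<and> z < w)" if "z \<in> B" for z
          using unblockedD[OF uwp B(1,3) _ B(7) t(1) _ that] True by blast
        have "v \<notin> B" using *[of v] w qp by auto
        moreover have "s < v" using *[of s] B by auto
        ultimately show ?thesis using av B by blast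
      qed
      \<comment> \<open>A point of \<open>B\<close> in [v, q] cannot be in \<open>A\<close>, whose
        points in [v, b] exceed \<open>q\<close>. Without such a point, \<open>s\<close> lies
        strictly between \<open>q\<close> and \<open>w\<close>, and either \<open>s\<close> is
        outside \<open>A\<close> or \<open>B\<close> would block the chord from \<open>q\<close> to
        \<open>w\<close>.\<close>
      obtain s' where s': "s' \<in> B - A" "a < s'" "s' < w"
      proof (cases "\<exists>z\<in>B. v \<le> z \<and> z \<le> q")
        case True
        then obtain z where "z \<in> B" "v \<le> z" "z \<le> q" by blast
        with Aqp[of z] w qp v that[of z] show ?thesis by force
      next
        case False
        have "\<not> s < v" using av B False qp by blast
        then have "q < s" using False B by auto
        moreover have "q \<notin> B" using False qp by auto
        ultimately show ?thesis using unblockedD[OF uqw B(1) _ B(3,4) _ B(6,7)] t by blast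
      qed
      have "abab (A - B) (B - A)"
        by (rule ababI[of a _ s' _ w t']) (use aA wA B s' t' in auto)
      then show False using free[OF A(1) B(1)] by blast
    qed
    then have "w \<le> v" using vmax w qp v by auto
    then show False using w qp by auto
  qed
  then show ?case using v by blast
qed

text \<open>Triangulate the two sides of the apex separately and add the base edge. A member that
  misses the apex but has points on both sides contains both \<open>a\<close> and \<open>b\<close>,
  because it blocks neither chord at the apex; so the base edge joins its two halves.\<close>

lemma abab_free_noncrossing_support_interval:
  assumes free: "\<And>A B. A \<in> \<A> \<Longrightarrow> B \<in> \<A> \<Longrightarrow> \<not> abab (A - B) (B - A)"
    and "a < b"
  shows "\<exists>T. symp T \<and> irreflp T \<and> noncrossing T \<and> T a b \<and>
    (\<forall>x y. T x y \<longrightarrow> x \<in> {a..b} \<and> y \<in> {a..b}) \<and> (\<forall>A\<in>\<A>. connected_on T (A \<inter> {a..b}))"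
  using assms(2)
proof (induction "b - a" arbitrary: a b rule: less_induct)
  case less
  show ?case
  proof (cases "b = a + 1")
    case True
    define T where "T = (\<lambda>x y. x = a \<and> y = b \<or> x = b \<and> y = a)"
    have "connected_on T (A \<inter> {a..b})" for A
      unfolding connected_on_def
    proof (intro ballI)
      fix x y assume xy: "x \<in> A \<inter> {a..b}" "y \<in> A \<inter> {a..b}"
      show "(\<lambda>u v. u \<in> A \<inter> {a..b} \<and> v \<in> A \<inter> {a..b} \<and> T u v)\<^sup>*\<^sup>* x y"
      proof (cases "x = y")
        case False
        then have "T x y" using True xy by (auto simp: T_def)
        with xy show ?thesis by (intro r_into_rtranclp) auto
      qed auto
    qed
    then show ?thesis
      using True by (intro exI[of _ T]) (auto simp: T_def symp_def irreflp_def noncrossing_def)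
  next
    case False
    with less.prems have "a + 2 \<le> b" by auto
    from unblocked_apex[OF free this] obtain v where v: "a < v" "v < b"
      "unblocked \<A> a b a v" "unblocked \<A> a b v b" by blast
    have "v - a < b - a" "b - v < b - a" using v by auto
    note IH = less.hyps[OF this(1) v(1)] less.hyps[OF this(2) v(2)]
    from IH(1) obtain T1
      where T1: "symp T1" "irreflp T1" "noncrossing T1" "T1 a v"
        "\<And>x y. T1 x y \<Longrightarrow> x \<in> {a..v} \<and> y \<in> {a..v}" "\<And>A. A \<in> \<A> \<Longrightarrow> connected_on T1 (A \<inter> {a..v})"
      by (elim exE conjE) (rule that, assumption, simp_all)
    from IH(2) obtain T2
      where T2: "symp T2" "irreflp T2" "noncrossing T2" "T2 v b"
        "\<And>x y. T2 x y \<Longrightarrow> x \<in> {v..b} \<and> y \<in> {v..b}" "\<And>A. A \<in> \<A> \<Longrightarrow> connected_on T2 (A \<inter> {v..b})"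
      by (elim exE conjE) (rule that, assumption, simp_all)
    define T where "T = (\<lambda>x y. T1 x y \<or> T2 x y \<or> x = a \<and> y = b \<or> x = b \<and> y = a)"
    have sym: "symp T" "irreflp T"
      using T1(1,2) T2(1,2) v unfolding T_def symp_def irreflp_def by auto
    have bd: "x \<in> {a..b} \<and> y \<in> {a..b}" if "T x y" for x y
      using that T1(5)[of x y] T2(5)[of x y] v unfolding T_def by auto
    have nc: "noncrossing T"
      unfolding noncrossing_def
    proof (intro allI impI notI)
      fix w x y z assume o: "w < x" "x < y" "y < z" and T: "T w y \<and> T x z"
      have "\<not> (w = a \<and> y = b \<or> w = b \<and> y = a)" "\<not> (x = a \<and> z = b \<or> x = b \<and> z = a)"
        using bd[of w y] bd[of x z] o T by auto
      then have "T1 w y \<or> T2 w y" "T1 x z \<or> T2 x z" using T unfolding T_def by auto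
      then show False
        using T1(3) T2(3) T1(5)[of w y] T1(5)[of x z] T2(5)[of w y] T2(5)[of x z] o
        unfolding noncrossing_def by fastforce
    qed
    have "connected_on T (A \<inter> {a..b})" if A: "A \<in> \<A>" for A
    proof -
      let ?A1 = "A \<inter> {a..v}" and ?A2 = "A \<inter> {v..b}"
      have c1: "connected_on T ?A1" and c2: "connected_on T ?A2"
        by (rule connected_on_mono[OF T1(6)[OF A]], simp add: T_def)
           (rule connected_on_mono[OF T2(6)[OF A]], simp add: T_def)
      have eq: "A \<inter> {a..b} = ?A1 \<union> ?A2" using v by auto
      consider "v \<in> A" | "v \<notin> A" "?A1 = {}" | "v \<notin> A" "?A2 = {}"
        | x y where "v \<notin> A" "x \<in> A" "a \<le> x" "x < v" "y \<in> A" "v < y" "y \<le> b"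
      proof -
        have "x < v" if "x \<in> ?A1" "v \<notin> A" for x using that by (cases "x = v") auto
        moreover have "v < y" if "y \<in> ?A2" "v \<notin> A" for y using that by (cases "y = v") auto
        ultimately show thesis using that by (metis Int_iff atLeastAtMost_iff ex_in_conv)
      qed
      then show ?thesis
      proof cases
        case 1
        then show ?thesis unfolding eq using v by (intro connected_on_Un[OF c1 c2, of v v]) auto
      next
        case 2
        then show ?thesis unfolding eq using c2 by auto
      next
        case 3
        then show ?thesis unfolding eq using c1 by auto
      next
        case (4 x y)
        have "a \<in> A"
          using unblockedD[OF v(3) A _ 4(1,2) _ 4(4,5)] 4 by (metis le_less)
        moreover have "b \<in> A"
          using unblockedD[OF v(4) A 4(1) _ 4(5,6) _ 4(2)] 4 by (metis le_less)
        ultimately show ?thesis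
          unfolding eq using v by (intro connected_on_Un[OF c1 c2, of a b]) (auto simp: T_def)
      qed
    qed
    moreover have "T a b" by (simp add: T_def)
    ultimately show ?thesis using sym nc bd by blast
  qed
qed

section \<open>An ABAB-free order on the intersected sets\<close>

text \<open>The cyclic notion: a cyclic alternation of four points, cut open anywhere, becomes one
  of the two linear patterns.\<close>

definition noninterleaving :: "nat set \<Rightarrow> nat set \<Rightarrow> bool" where
  "noninterleaving S T \<longleftrightarrow> \<not> abab S T \<and> \<not> abab T S"

lemma noninterleaving_between:
  assumes "noninterleaving S T" "a \<in> S" "c \<in> S" "b \<in> T" "d \<in> T" "a < b" "b < c" "d \<notin> S"
  shows "a < d \<and> d < c"
proof (rule ccontr)
  assume "\<not> ?thesis"
  moreover have "d \<noteq> a" "d \<noteq> c" using assms by auto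
  ultimately have "d < a \<or> c < d" by linarith
  then have "abab S T \<or> abab T S"
    using assms ababI[of a S b T c d] ababI[of d T a S b c] by blast
  then show False using assms(1) by (simp add: noninterleaving_def)
qed

text \<open>At equal minima this is the lexicographic order of characteristic sequences, so an
  earlier extra point makes a set later, opposite to the effect of an earlier minimum.
  \<open>Min\<close> acts only as some number attached to each set, which makes this a strict linear
  order on arbitrary sets.\<close>

definition set_less :: "nat set \<Rightarrow> nat set \<Rightarrow> bool" where
  "set_less S T \<longleftrightarrow> Min S < Min T \<or> Min S = Min T \<and> (\<exists>y\<in>T - S. \<forall>x<y. x \<in> S \<longleftrightarrow> x \<in> T)"

lemma set_less_trans:
  assumes "set_less S T" "set_less T U" shows "set_less S U"
proof (cases "Min S < Min U")
  case False
  with assms have eq: "Min S = Min T" "Min T = Min U" unfolding set_less_def by auto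
  with assms obtain y z where y: "y \<in> T - S" "\<forall>x<y. x \<in> S \<longleftrightarrow> x \<in> T"
    and z: "z \<in> U - T" "\<forall>x<z. x \<in> T \<longleftrightarrow> x \<in> U" unfolding set_less_def by auto
  have "min y z \<in> U - S" "\<forall>x<min y z. x \<in> S \<longleftrightarrow> x \<in> U"
    using y z by (auto simp: min_def) (metis linorder_neqE_nat not_le)+
  then show ?thesis unfolding set_less_def using eq by metis
qed (simp add: set_less_def)

lemma set_less_irrefl: "\<not> set_less S S"
  by (simp add: set_less_def)

lemma set_less_total:
  assumes "S \<noteq> T" shows "set_less S T \<or> set_less T S"
proof -
  have ex: "\<exists>x. x \<in> S \<longleftrightarrow> x \<notin> T" using assms by blast
  define y where "y = (LEAST x. x \<in> S \<longleftrightarrow> x \<notin> T)"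
  have "y \<in> S \<longleftrightarrow> y \<notin> T" unfolding y_def by (rule LeastI_ex[OF ex])
  moreover have "x \<in> S \<longleftrightarrow> x \<in> T" if "x < y" for x
    using not_less_Least[of x "\<lambda>x. x \<in> S \<longleftrightarrow> x \<notin> T"] that unfolding y_def by blast
  ultimately show ?thesis unfolding set_less_def
    by (cases "Min S" "Min T" rule: linorder_cases) (simp_all, metis DiffI)
qed

lemma finite_linear_order_rank:
  assumes "finite X" and trans: "\<And>x y z. lt x y \<Longrightarrow> lt y z \<Longrightarrow> lt x z"
    and irrefl: "\<And>x. \<not> lt x x" and total: "\<And>x y. x \<noteq> y \<Longrightarrow> lt x y \<or> lt y x"
  obtains f :: "'a \<Rightarrow> nat" where "inj_on f X" "\<And>x y. x \<in> X \<Longrightarrow> y \<in> X \<Longrightarrow> f x < f y \<Longrightarrow> lt x y"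
proof -
  define f where "f x = card {z \<in> X. lt z x}" for x
  have mono: "f x < f y" if "x \<in> X" "lt x y" for x y
    unfolding f_def
  proof (rule psubset_card_mono)
    show "{z \<in> X. lt z x} \<subset> {z \<in> X. lt z y}"
      using that trans irrefl by blast
  qed (use assms(1) in simp)
  show ?thesis
  proof
    show "inj_on f X"
      by (rule inj_onI) (metis mono total less_irrefl)
    show "lt x y" if "x \<in> X" "y \<in> X" "f x < f y" for x y
      using mono[of y x] total[of x y] that by (metis less_asym less_irrefl)
  qed
qed

text \<open>With different minima, \<open>Min S\<close> lies outside the span of \<open>T\<close>;
  since \<open>S - T\<close> does not interleave with \<open>T\<close>, the point \<open>s\<close>
  is outside that span too, and \<open>K\<close> follows \<open>s\<close> because it avoids
  \<open>T\<close>. With equal minima, the first difference \<open>y\<close> is trapped between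
  \<open>Min S\<close> and \<open>s\<close>, and therefore so is every point of
  \<open>T - S\<close>.\<close>

lemma set_less_cases:
  assumes less: "set_less S T" and fin: "finite S" "finite T"
    and ST: "noninterleaving S (T - S)" "noninterleaving T (S - T)"
    and K: "noninterleaving T K" "T \<inter> K = {}" "s \<in> S" "s \<in> K"
    and t: "t \<in> T" "t \<notin> S"
  obtains "Min S < Min T" "\<And>k. k \<in> K \<Longrightarrow> k < Min T \<or> Max T < k"
    | "Min S = Min T" "t < s"
proof -
  have sT: "s \<notin> T" using K by auto
  have mS: "Min S \<in> S" "Min T \<in> T" "Max T \<in> T" using fin K(3) t(1) by (auto intro!: Min_in Max_in)
  consider "Min S < Min T" | y where "Min S = Min T" "y \<in> T - S" "\<forall>x<y. x \<in> S \<longleftrightarrow> x \<in> T"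
    using less unfolding set_less_def by blast
  then show ?thesis
  proof cases
    case 1
    have mST: "Min S \<in> S - T" using 1 mS fin(2) by (auto simp: leD)
    have s: "\<not> (Min T < s \<and> s < Max T)"
      using noninterleaving_between[OF ST(2) mS(2,3) _ mST, of s] 1 K(3) sT mST by auto
    have "k < Min T \<or> Max T < k" if k: "k \<in> K" for k
    proof (rule ccontr)
      assume "\<not> ?thesis"
      moreover have "k \<noteq> Min T" "k \<noteq> Max T" using mS K(2) k by auto
      ultimately have "Min T < k" "k < Max T" by auto
      then show False
        using noninterleaving_between[OF K(1) mS(2,3) k K(4)] s sT by blast
    qed
    with 1 that show ?thesis by blast
  next
    case 2
    have "y < s" using 2 K(3) sT by (metis DiffD1 DiffD2 linorder_neqE_nat)
    have "Min S < y"
    proof -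
      have "Min S \<le> y" using 2 fin by simp
      then show ?thesis using 2 mS by (metis DiffD2 le_neq_implies_less)
    qed
    have "t < s"
    proof (rule ccontr)
      assume "\<not> t < s"
      then have "s < t" using t K(3) by (metis linorder_neqE_nat)
      then show False
        using noninterleaving_between[OF ST(1) mS(1) K(3) 2(2), of t] \<open>Min S < y\<close> \<open>y < s\<close> t by auto
    qed
    with 2 that show ?thesis by blast
  qed
qed

text \<open>The previous dichotomy is applied to \<open>H1\<close>, \<open>H2\<close> with
  \<open>K\<close> and to \<open>H2\<close>, \<open>H3\<close> with \<open>K'\<close>. Each outcome
  fixes enough of the order of the four witnesses to contradict either an alternation of
  \<open>K\<close> and \<open>K'\<close> or the way in which a missed set traps the other family
  member.\<close>

lemma set_less_hitting_abab_free:
  assumes less: "set_less H1 H2" "set_less H2 H3" "set_less H3 H4"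
    and fin: "finite H1" "finite H2" "finite H3" "finite H4"
    and HH: "noninterleaving H1 (H2 - H1)" "noninterleaving H2 (H1 - H2)"
      "noninterleaving H2 (H3 - H2)" "noninterleaving H3 (H2 - H3)"
      "noninterleaving H3 (H4 - H3)" "noninterleaving H4 (H3 - H4)"
    and HK: "noninterleaving H1 K'" "noninterleaving H2 K" "noninterleaving H3 K'" "noninterleaving H4 K"
    and KK: "\<not> abab (K - K') (K' - K)" "\<not> abab (K' - K) (K - K')"
    and hit: "k1 \<in> H1 \<inter> K" "k2 \<in> H2 \<inter> K'" "k3 \<in> H3 \<inter> K" "k4 \<in> H4 \<inter> K'"
    and miss: "H1 \<inter> K' = {}" "H2 \<inter> K = {}" "H3 \<inter> K' = {}" "H4 \<inter> K = {}"
  shows False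
proof -
  have k: "k1 \<in> H1" "k2 \<in> H2" "k3 \<in> H3" "k4 \<in> H4" "k1 \<in> K" "k2 \<in> K'" "k3 \<in> K" "k4 \<in> K'"
    "k1 \<notin> H2" "k2 \<notin> H1" "k2 \<notin> H3" "k3 \<notin> H2" "k3 \<notin> H4" "k4 \<notin> H3" "k4 \<notin> H1"
    "k1 \<in> K - K'" "k2 \<in> K' - K" "k3 \<in> K - K'" "k4 \<in> K' - K"
    using hit miss by auto
  have m: "Min H1 \<in> H1" "Min H2 \<in> H2" "Min H1 \<le> k1" "Min H2 \<le> k2" "Min H3 \<le> k3" "Min H4 \<le> k4"
    "k2 \<le> Max H2" "k3 \<le> Max H3" using fin k(1-4) by (auto intro!: Min_in)
  have m34: "Min H3 \<le> Min H4" using less(3) unfolding set_less_def by auto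
  \<comment> \<open>Before \<open>k2\<close> the point \<open>k1\<close> opens the alternation;
    after \<open>k4\<close> it closes the one with the roles exchanged.\<close>
  have no: "\<not> (k2 < k3 \<and> k3 < k4 \<and> (k1 < k2 \<or> k4 < k1))"
    using KK ababI[OF k(16,17,18,19)] ababI[OF k(17,18,19,16)] by auto
  note c12 = set_less_cases[OF less(1) fin(1,2) HH(1,2) HK(2) miss(2) k(1,5,2,10)]
  note c23 = set_less_cases[OF less(2) fin(2,3) HH(3,4) HK(3) miss(3) k(2,6,3,12)]
  note b1 = noninterleaving_between[OF HK(1) m(1) k(1,6,8)]
  note b2 = noninterleaving_between[OF HK(2) m(2) k(2,7,5)]
  show False
  proof (rule c23)
    assume 23: "Min H2 < Min H3" "\<And>k. k \<in> K' \<Longrightarrow> k < Min H3 \<or> Max H3 < k"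
    \<comment> \<open>\<open>k4\<close> is not below \<open>Min H3\<close>, as minima increase
      weakly along the order, so it must lie beyond the span of \<open>H3\<close>.\<close>
    have k34: "k3 < k4" using 23(2)[OF k(8)] m m34 by auto
    show False
    proof (rule c12)
      assume 12: "Min H1 < Min H2" "\<And>k. k \<in> K \<Longrightarrow> k < Min H2 \<or> Max H2 < k"
      have "k2 < k3" using 12(2)[OF k(7)] m 23 by auto
      with no k34 have "\<not> k1 < k2" "\<not> k4 < k1" by auto
      moreover have "k1 \<noteq> k2" "k1 \<noteq> k4" using k by auto
      ultimately show False using b1 12(1) m k by auto
    next
      assume 12: "Min H1 = Min H2" "k2 < k1"
      have "Min H1 < k2" using m 12 k by (metis le_neq_implies_less)
      then have "k4 < k1" using b1 12 k by auto
      with no k34 have "\<not> k2 < k3" by auto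
      then have "k3 < k2" using k by (metis linorder_neqE_nat)
      then show False using b2 23(1) m k 12 by auto
    qed
  next
    assume 23: "Min H2 = Min H3" "k3 < k2"
    have "Min H2 < k3" using m 23 k by (metis le_neq_implies_less)
    show False
    proof (rule c12)
      assume 12: "Min H1 < Min H2" "\<And>k. k \<in> K \<Longrightarrow> k < Min H2 \<or> Max H2 < k"
      show False using 12(2)[OF k(7)] m 23 by auto
    next
      assume 12: "Min H1 = Min H2" "k2 < k1"
      then show False using b2 \<open>Min H2 < k3\<close> 23 k by auto
    qed
  qed
qed

lemma noncrossing_intersection_support_nat:
  fixes \<H> \<K> :: "nat set set"
  assumes fin: "finite \<H>" "\<And>H. H \<in> \<H> \<Longrightarrow> finite H"
    and HH: "\<And>H H'. H \<in> \<H> \<Longrightarrow> H' \<in> \<H> \<Longrightarrow> noninterleaving H (H' - H)"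
    and KK: "\<And>K K'. K \<in> \<K> \<Longrightarrow> K' \<in> \<K> \<Longrightarrow> noninterleaving K (K' - K)"
    and HK: "\<And>H K. H \<in> \<H> \<Longrightarrow> K \<in> \<K> \<Longrightarrow> H \<inter> K = {} \<Longrightarrow> noninterleaving H K"
  obtains f :: "nat set \<Rightarrow> nat" and T where "inj_on f \<H>" "symp T" "irreflp T" "noncrossing T"
    "\<And>K. K \<in> \<K> \<Longrightarrow> connected_on T (f ` {H \<in> \<H>. H \<inter> K \<noteq> {}})"
proof -
  obtain f :: "nat set \<Rightarrow> nat" where f: "inj_on f \<H>"
    "\<And>H H'. H \<in> \<H> \<Longrightarrow> H' \<in> \<H> \<Longrightarrow> f H < f H' \<Longrightarrow> set_less H H'"
    using finite_linear_order_rank[OF fin(1), of set_less] set_less_trans set_less_irrefl set_less_total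
    by metis
  define A where "A K = f ` {H \<in> \<H>. H \<inter> K \<noteq> {}}" for K
  have free: "\<not> abab (A K - A K') (A K' - A K)" if K: "K \<in> \<K>" "K' \<in> \<K>" for K K'
  proof
    have *: "\<exists>H\<in>\<H>. x = f H \<and> H \<inter> L \<noteq> {} \<and> H \<inter> L' = {}" if "x \<in> A L - A L'" for x L L'
      using that unfolding A_def by blast
    assume "abab (A K - A K') (A K' - A K)"
    then obtain x1 x2 x3 x4 where x: "x1 \<in> A K - A K'" "x2 \<in> A K' - A K" "x3 \<in> A K - A K'"
      "x4 \<in> A K' - A K" "x1 < x2" "x2 < x3" "x3 < x4" unfolding abab_def by blast
    obtain H1 H2 H3 H4 where H: "H1 \<in> \<H>" "H2 \<in> \<H>" "H3 \<in> \<H>" "H4 \<in> \<H>"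
      and e: "x1 = f H1" "x2 = f H2" "x3 = f H3" "x4 = f H4"
      and hit: "H1 \<inter> K \<noteq> {}" "H2 \<inter> K' \<noteq> {}" "H3 \<inter> K \<noteq> {}" "H4 \<inter> K' \<noteq> {}"
      and miss: "H1 \<inter> K' = {}" "H2 \<inter> K = {}" "H3 \<inter> K' = {}" "H4 \<inter> K = {}"
      using *[OF x(1)] *[OF x(2)] *[OF x(3)] *[OF x(4)] by blast
    obtain k1 k2 k3 k4 where k: "k1 \<in> H1 \<inter> K" "k2 \<in> H2 \<inter> K'" "k3 \<in> H3 \<inter> K" "k4 \<in> H4 \<inter> K'"
      using hit by blast
    have "\<not> abab (L - L') (L' - L)" if "L \<in> \<K>" "L' \<in> \<K>" for L L'
      using KK[OF that(2,1)] unfolding noninterleaving_def abab_def by blast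
    note KK' = this[OF K] this[OF K(2,1)]
    show False
      by (rule set_less_hitting_abab_free[of H1 H2 H3 H4 K' K, OF _ _ _ _ _ _ _ _ _ _ _ _ _ _ _ _ _ KK' k miss])
         (use x e H f(2) fin HH HK K miss in auto)
  qed
  \<comment> \<open>\<open>insert 0\<close> covers an empty family, and \<open>Suc\<close> gives the
    interval from 0 to \<open>N\<close> the two distinct ends that the triangulation needs.\<close>
  define N where "N = Suc (Max (insert 0 (f ` \<H>)))"
  have N: "f H \<le> N" if "H \<in> \<H>" for H
    unfolding N_def using fin(1) that by (intro le_SucI Max_ge) auto
  have "\<exists>T. symp T \<and> irreflp T \<and> noncrossing T \<and> T 0 N \<and>
    (\<forall>x y. T x y \<longrightarrow> x \<in> {0..N} \<and> y \<in> {0..N}) \<and> (\<forall>B\<in>A ` \<K>. connected_on T (B \<inter> {0..N}))"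
    by (rule abab_free_noncrossing_support_interval) (use free N_def in auto)
  then obtain T where T: "symp T" "irreflp T" "noncrossing T" "\<And>B. B \<in> A ` \<K> \<Longrightarrow> connected_on T (B \<inter> {0..N})"
    by (elim exE conjE) (rule that, assumption+, erule bspec)
  have "connected_on T (A K)" if "K \<in> \<K>" for K
  proof -
    have "A K \<inter> {0..N} = A K" unfolding A_def using N by auto
    with T(4)[of "A K"] that show ?thesis by auto
  qed
  with that[OF f(1) T(1-3)] show ?thesis unfolding A_def by blast
qed

section \<open>Straight-line drawings on a parabola\<close>

text \<open>Points in strictly convex position whose order along the curve is that of the real
  parts; the region below the curve is left free for the outer face.\<close>

definition parab :: "nat \<Rightarrow> complex" where
  "parab n = Complex (real n) ((real n)\<^sup>2)"

text \<open>The height of a chord above the parabola factors through the distances to its ends.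
  Hence chords lie above the curve, touch it only at their ends, and can be compared factor by
  factor.\<close>

lemma Im_minus_square_on_parab_chord:
  assumes "z \<in> closed_segment (parab a) (parab b)"
  shows "Im z - (Re z)\<^sup>2 = (Re z - real a) * (real b - Re z)"
proof -
  from assms obtain u where "z = (1 - u) *\<^sub>R parab a + u *\<^sub>R parab b"
    unfolding closed_segment_def by blast
  then have "Re z = (1 - u) * real a + u * real b" "Im z = (1 - u) * (real a)\<^sup>2 + u * (real b)\<^sup>2"
    by (simp_all add: parab_def)
  then show ?thesis unfolding power2_eq_square by algebra
qed

lemma Re_on_parab_chord:
  assumes "z \<in> closed_segment (parab a) (parab b)" "a \<le> b"
  shows "real a \<le> Re z \<and> Re z \<le> real b"
proof -
  from assms obtain u where u: "0 \<le> u" "u \<le> 1" "z = (1 - u) *\<^sub>R parab a + u *\<^sub>R parab b"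
    unfolding closed_segment_def by blast
  then have "Re z = (1 - u) * real a + u * real b" by (simp add: parab_def)
  then have z: "Re z = real a + u * (real b - real a)" by (simp add: algebra_simps)
  have "0 \<le> u * (real b - real a)" "u * (real b - real a) \<le> 1 * (real b - real a)"
    using u assms(2) by (simp, intro mult_right_mono) auto
  then show ?thesis using z by simp
qed

lemma parab_chord_at_parab:
  assumes "z \<in> closed_segment (parab a) (parab b)" "Im z = (Re z)\<^sup>2"
  shows "z = parab a \<or> z = parab b"
  using Im_minus_square_on_parab_chord[OF assms(1)] assms(2)
  by (auto simp: parab_def complex_eq_iff)

text \<open>At a common point the heights over the two chords agree. Both factors are at least as
  large for the outer chord, so equality forces a shared end, and the common point to be that
  end.\<close>

lemma parab_chords_Int_nested:
  assumes z: "z \<in> closed_segment (parab a) (parab b)" "z \<in> closed_segment (parab c) (parab d)"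
    and "a \<le> c" "c < d" "d \<le> b" "(a, b) \<noteq> (c, d)"
  shows "z \<in> parab ` ({a, b} \<inter> {c, d})"
proof -
  let ?x = "Re z"
  have x: "real c \<le> ?x" "?x \<le> real d" using Re_on_parab_chord[OF z(2)] assms by auto
  have eq: "(?x - a) * (b - ?x) = (?x - c) * (d - ?x)"
    using Im_minus_square_on_parab_chord[OF z(1)] Im_minus_square_on_parab_chord[OF z(2)] by simp
  have nn: "real a \<le> real c" "real d \<le> real b" using assms by auto
  have le: "(?x - c) * (d - ?x) \<le> (?x - c) * (b - ?x)" "(?x - c) * (b - ?x) \<le> (?x - a) * (b - ?x)"
    using x nn by (auto intro!: mult_left_mono mult_right_mono)
  with eq have e1: "(?x - c) * (b - ?x) = (?x - c) * (d - ?x)" and e2: "(?x - a) * (b - ?x) = (?x - c) * (b - ?x)"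
    by auto
  have "?x = c \<or> b = d" using e1 by auto
  moreover have "?x = b \<or> a = c" using e2 by auto
  ultimately have "(?x = c \<and> a = c) \<or> (?x = b \<and> b = d)" using assms x by auto
  moreover have "Im z = ?x\<^sup>2" if "?x = c \<and> a = c \<or> ?x = b \<and> b = d"
    using Im_minus_square_on_parab_chord[OF z(1)] that by auto
  ultimately show ?thesis by (auto simp: parab_def complex_eq_iff image_iff)
qed

lemma parab_chords_Int:
  assumes nc: "noncrossing T" "symp T" "irreflp T" and T: "T a b" "T c d" and ne: "{a, b} \<noteq> {c, d}"
    and z: "z \<in> closed_segment (parab a) (parab b)" "z \<in> closed_segment (parab c) (parab d)"
  shows "z \<in> parab ` ({a, b} \<inter> {c, d})"
proof -
  have *: "z \<in> parab ` ({a, b} \<inter> {c, d})"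
    if T: "T a b" "T c d" and ne: "{a, b} \<noteq> {c, d}" and o: "a < b" "c < d" "a \<le> c"
      and z: "z \<in> closed_segment (parab a) (parab b)" "z \<in> closed_segment (parab c) (parab d)" for a b c d
  proof -
    consider "b < c" | "b = c" | "c < b" "d \<le> b" | "c < b" "b < d" by linarith
    then show ?thesis
    proof cases
      case 1
      then show ?thesis using Re_on_parab_chord[OF z(1)] Re_on_parab_chord[OF z(2)] o by auto
    next
      case 2
      then have "Re z = b" using Re_on_parab_chord[OF z(1)] Re_on_parab_chord[OF z(2)] o by auto
      moreover then have "Im z = (Re z)\<^sup>2" using Im_minus_square_on_parab_chord[OF z(1)] by auto
      ultimately show ?thesis using 2 by (auto simp: parab_def complex_eq_iff)
    next
      case 3
      then show ?thesis using parab_chords_Int_nested[OF z] o ne by auto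
    next
      case 4
      \<comment> \<open>If \<open>a < c\<close>, then a < c < b < d would be a crossing
        pair.\<close>
      have "a = c" using nc(1) T 4 o unfolding noncrossing_def by (metis le_neq_implies_less)
      then show ?thesis using parab_chords_Int_nested[OF z(2,1)] o ne 4 by auto
    qed
  qed
  have **: "z \<in> parab ` ({a, b} \<inter> {c, d})"
    if T: "T a b" "T c d" and ne: "{a, b} \<noteq> {c, d}" and o: "a < b" "c < d"
      and z: "z \<in> closed_segment (parab a) (parab b)" "z \<in> closed_segment (parab c) (parab d)" for a b c d
  proof (cases "a \<le> c")
    case False
    then show ?thesis using *[OF T(2,1) _ o(2,1) _ z(2,1)] ne by (simp add: Int_commute)
  qed (use * that in blast)
  have sw: "T b a" "T d c" using nc(2) T by (auto dest: sympD)
  have "a \<noteq> b" "c \<noteq> d" using nc(3) T by (auto simp: irreflp_def)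
  then consider "a < b" "c < d" | "b < a" "c < d" | "a < b" "d < c" | "b < a" "d < c" by linarith
  then show ?thesis
  proof cases
    case 1 then show ?thesis using **[OF T ne 1 z] by simp
  next
    case 2 then show ?thesis using **[OF sw(1) T(2) _ 2] ne z by (simp add: insert_commute closed_segment_commute)
  next
    case 3 then show ?thesis using **[OF T(1) sw(2) _ 3] ne z by (simp add: insert_commute closed_segment_commute)
  next
    case 4 then show ?thesis using **[OF sw _ 4] ne z by (simp add: insert_commute closed_segment_commute)
  qed
qed

text \<open>\<open>?g\<close> is an involution of the plane that exchanges this region with the open
  upper half plane.\<close>

lemma connected_below_parabola: "connected {z. Im z < (Re z)\<^sup>2}"
proof -
  let ?g = "\<lambda>z. Complex (Re z) ((Re z)\<^sup>2 - Im z)"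
  have "{z. Im z < (Re z)\<^sup>2} = ?g ` {z. Im z > 0}" (is "?L = ?R")
  proof
    show "?L \<subseteq> ?R"
    proof
      fix z assume "z \<in> ?L"
      then have "?g z \<in> {z. Im z > 0}" "z = ?g (?g z)" by (auto simp: complex_eq_iff)
      then show "z \<in> ?R" by blast
    qed
  qed auto
  moreover have "continuous_on {z. Im z > 0} ?g"
    unfolding Complex_eq by (intro continuous_intros)
  ultimately show ?thesis
    using connected_continuous_image convex_connected[OF convex_halfspace_Im_gt[of 0]] by simp
qed

lemma unbounded_below_parabola: "\<not> bounded {z. Im z < (Re z)\<^sup>2}"
proof
  assume "bounded {z. Im z < (Re z)\<^sup>2}"
  then obtain B where B: "\<And>z. Im z < (Re z)\<^sup>2 \<Longrightarrow> norm z \<le> B" by (auto simp: bounded_iff)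
  have "norm (Complex 0 (- (\<bar>B\<bar> + 1))) \<le> B" by (rule B) simp
  then show False by (simp add: cmod_def)
qed

lemma parab_in_closure_below: "parab n \<in> closure {z. Im z < (Re z)\<^sup>2}"
  unfolding closure_approachable
proof (intro allI impI)
  fix e :: real assume "0 < e"
  then show "\<exists>y\<in>{z. Im z < (Re z)\<^sup>2}. dist y (parab n) < e"
    by (intro bexI[of _ "Complex (real n) ((real n)\<^sup>2 - e / 2)"]) (auto simp: parab_def dist_norm cmod_def)
qed

text \<open>The region below the parabola is connected, unbounded and disjoint from the drawing, so
  it lies in a single unbounded face. Every vertex is a limit of points of that region and hence on
  the frontier of the face.\<close>

lemma noncrossing_imp_outerplanar:
  fixes V :: "'a set"
  assumes f: "inj_on f V" and Q: "simple_graph V Q"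
    and T: "symp T" "irreflp T" "noncrossing T" "\<And>u v. Q u v \<Longrightarrow> T (f u) (f v)"
  shows "outerplanar V Q"
proof -
  define pos where "pos v = parab (f v)" for v
  define \<gamma> where "\<gamma> u v = linepath (pos u) (pos v)" for u v
  let ?D = "drawing V Q pos \<gamma>" and ?P = "{z. Im z < (Re z)\<^sup>2}"
  have fin: "finite V" and QV: "\<And>u v. Q u v \<Longrightarrow> u \<in> V \<and> v \<in> V"
    using Q unfolding simple_graph_def by auto
  have inj_parab: "inj parab" by (rule injI) (simp add: parab_def)
  have inj: "inj_on pos V"
    using f inj_parab unfolding pos_def inj_on_def by auto
  have ne: "f u \<noteq> f v" if "Q u v" for u v
    using T(2) T(4)[OF that] unfolding irreflp_def by metis
  have "plane_embedding V Q pos \<gamma>"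
    unfolding plane_embedding_def
  proof (intro conjI allI impI)
    show "inj_on pos V" by (rule inj)
    fix u v assume uv: "Q u v"
    have "pos u \<noteq> pos v" using ne[OF uv] inj_parab by (auto simp: pos_def inj_def)
    then show "arc (\<gamma> u v)" unfolding \<gamma>_def by simp
    show "pathstart (\<gamma> u v) = pos u" "pathfinish (\<gamma> u v) = pos v" "\<gamma> v u = reversepath (\<gamma> u v)"
      by (simp_all add: \<gamma>_def)
    show "path_image (\<gamma> u v) \<inter> pos ` V \<subseteq> {pos u, pos v}"
    proof
      fix z assume "z \<in> path_image (\<gamma> u v) \<inter> pos ` V"
      then have "z \<in> closed_segment (parab (f u)) (parab (f v))" "Im z = (Re z)\<^sup>2"
        by (auto simp: \<gamma>_def pos_def parab_def)
      from parab_chord_at_parab[OF this] show "z \<in> {pos u, pos v}" by (simp add: pos_def)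
    qed
  next
    fix u v x y assume uv: "Q u v" and xy: "Q x y" and neq: "{u, v} \<noteq> {x, y}"
    have V: "u \<in> V" "v \<in> V" "x \<in> V" "y \<in> V" using QV uv xy by auto
    have neq': "{f u, f v} \<noteq> {f x, f y}"
    proof
      assume "{f u, f v} = {f x, f y}"
      then have "f ` {u, v} = f ` {x, y}" by simp
      then have "{u, v} = {x, y}" using inj_on_image_eq_iff[OF f, of "{u, v}" "{x, y}"] V by simp
      with neq show False ..
    qed
    show "path_image (\<gamma> u v) \<inter> path_image (\<gamma> x y) \<subseteq> pos ` ({u, v} \<inter> {x, y})"
    proof
      fix z assume "z \<in> path_image (\<gamma> u v) \<inter> path_image (\<gamma> x y)"
      then have "z \<in> closed_segment (parab (f u)) (parab (f v))" "z \<in> closed_segment (parab (f x)) (parab (f y))"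
        by (auto simp: \<gamma>_def pos_def)
      from parab_chords_Int[OF T(3,1,2) T(4)[OF uv] T(4)[OF xy] neq' this]
      have "z \<in> parab ` ({f u, f v} \<inter> {f x, f y})" .
      moreover have "{f u, f v} \<inter> {f x, f y} \<subseteq> f ` ({u, v} \<inter> {x, y})"
        using f V unfolding inj_on_def by auto
      ultimately have "z \<in> parab ` f ` ({u, v} \<inter> {x, y})" by (meson image_mono subsetD)
      then show "z \<in> pos ` ({u, v} \<inter> {x, y})" by (simp add: pos_def image_image)
    qed
  qed
  moreover have "\<exists>F\<in>components (- ?D). \<not> bounded F \<and> (\<forall>v\<in>V. pos v \<in> frontier F)"
  proof -
    have PD: "?P \<subseteq> - ?D"
    proof (rule ccontr)
      assume "\<not> ?thesis"
      then obtain z where z: "Im z < (Re z)\<^sup>2" "z \<in> ?D" by blast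
      have "z \<notin> pos ` V" using z by (auto simp: pos_def parab_def)
      then obtain u v where uv: "Q u v" "z \<in> closed_segment (parab (f u)) (parab (f v))"
        using z unfolding drawing_def \<gamma>_def pos_def by auto
      have "Im z - (Re z)\<^sup>2 \<ge> 0" if "z \<in> closed_segment (parab a) (parab b)" "a \<le> b" for a b
        using Im_minus_square_on_parab_chord[OF that(1)] Re_on_parab_chord[OF that] by simp
      with uv(2) z show False by (metis closed_segment_commute diff_ge_0_iff_ge linorder_not_less nle_le)
    qed
    have "{z. Im z < (Re z)\<^sup>2} \<noteq> {}" using unbounded_below_parabola bounded_empty by metis
    then obtain F where F: "F \<in> components (- ?D)" "?P \<subseteq> F"
      using exists_component_superset[OF PD _ connected_below_parabola] PD by blast
    have "\<not> bounded F" using F(2) unbounded_below_parabola bounded_subset by blast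
    moreover have "pos v \<in> frontier F" if "v \<in> V" for v
    proof -
      have "pos v \<in> closure F"
        using parab_in_closure_below closure_mono[OF F(2)] unfolding pos_def by blast
      moreover have "pos v \<notin> F"
        using in_components_subset[OF F(1)] that unfolding drawing_def by auto
      ultimately show ?thesis unfolding frontier_def using interior_subset by blast
    qed
    ultimately show ?thesis using F(1) by blast
  qed
  ultimately show ?thesis unfolding outerplanar_def by blast
qed

section \<open>Noncrossing vertex orders\<close>

text \<open>Length two is allowed: a single edge counts as a cycle, so a block consisting of one
  edge needs no separate treatment.\<close>

definition graph_cycle :: "('a \<Rightarrow> 'a \<Rightarrow> bool) \<Rightarrow> 'a list \<Rightarrow> bool" where
  "graph_cycle E c \<longleftrightarrow> 2 \<le> length c \<and> distinct c \<and> successively E c \<and> E (last c) (hd c)"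

lemma graph_cycle_rotate:
  assumes "graph_cycle E (p @ q)" shows "graph_cycle E (q @ p)"
  using assms unfolding graph_cycle_def
  by (cases "p = []"; cases "q = []") (auto simp: successively_append_iff)

lemma successively_rev_sym:
  assumes "symp E" shows "successively E (rev xs) \<longleftrightarrow> successively E xs"
proof -
  have "(\<lambda>x y. E y x) = E" using assms by (auto simp: symp_def intro!: ext)
  then have "successively (\<lambda>x y. E y x) xs = successively E xs"
    by (rule arg_cong[where f = "\<lambda>P. successively P xs"])
  then show ?thesis by (simp add: successively_rev)
qed

lemma graph_cycle_path:
  assumes "graph_cycle E (a # xs @ b # ys)" "symp E"
  shows "successively E (a # xs @ [b])" "successively E (a # rev ys @ [b])"
    "distinct (a # b # xs @ rev ys)"
proof -
  have c: "successively E ((a # xs) @ b # ys)" "E (last (b # ys)) a" "distinct (a # b # xs @ ys)"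
    using assms(1) unfolding graph_cycle_def by auto
  have "successively E ((a # xs) @ [b])"
    using c(1) unfolding successively_append_iff by simp
  then show "successively E (a # xs @ [b])" by simp
  show "distinct (a # b # xs @ rev ys)" using c(3) by auto
  have "successively E ((b # ys) @ [a])"
    using c(1,2) unfolding successively_append_iff by simp
  then have "successively E (b # ys @ [a])" by simp
  then show "successively E (a # rev ys @ [b])"
    using successively_rev_sym[OF assms(2), of "b # ys @ [a]"] by simp
qed

lemma rtranclp_imp_distinct_path:
  assumes "(\<lambda>u v. u \<in> S \<and> v \<in> S \<and> E u v)\<^sup>*\<^sup>* x y" "x \<in> S"
  shows "\<exists>p. p \<noteq> [] \<and> hd p = x \<and> last p = y \<and> distinct p \<and> set p \<subseteq> S \<and> successively E p"
  using assms
proof (induction rule: rtranclp_induct)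
  case base
  then show ?case by (intro exI[of _ "[x]"]) auto
next
  case (step y z)
  then obtain p where p: "p \<noteq> []" "hd p = x" "last p = y" "distinct p" "set p \<subseteq> S" "successively E p"
    by blast
  show ?case
  proof (cases "z \<in> set p")
    case True
    then obtain q r where "p = q @ z # r" by (meson split_list)
    then show ?thesis using p
      by (intro exI[of _ "q @ [z]"]) (auto simp: successively_append_iff hd_append)
  next
    case False
    then show ?thesis using p step.hyps
      by (intro exI[of _ "p @ [z]"]) (auto simp: successively_append_iff)
  qed
qed

lemma list_split_two:
  assumes "i < k" "k < length c"
  obtains p xs s where "c = p @ c ! i # xs @ c ! k # s" "length p = i" "length p + length xs + 1 = k"
proof -
  have 1: "c = take k c @ c ! k # drop (Suc k) c" using assms by (intro id_take_nth_drop) auto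
  have "take k c = take i (take k c) @ take k c ! i # drop (Suc i) (take k c)"
    using assms by (intro id_take_nth_drop) auto
  then have "take k c = take i c @ c ! i # drop (Suc i) (take k c)" using assms by (simp add: min_def)
  from arg_cong[OF this, of "\<lambda>l. l @ c ! k # drop (Suc k) c"] 1
  have 2: "c = take i c @ c ! i # drop (Suc i) (take k c) @ c ! k # drop (Suc k) c" by simp
  show ?thesis
    by (rule that[of "take i c" "drop (Suc i) (take k c)" "drop (Suc k) c"])
       (use 2 assms in \<open>auto simp: min_def\<close>)
qed

text \<open>\<open>f\<close> is the spine order of a one-page book embedding of the subgraph induced
  on \<open>S\<close>.\<close>

definition noncrossing_on :: "('a \<Rightarrow> 'a \<Rightarrow> bool) \<Rightarrow> ('a \<Rightarrow> nat) \<Rightarrow> 'a set \<Rightarrow> bool" where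
  "noncrossing_on E f S \<longleftrightarrow> (\<forall>a\<in>S. \<forall>b\<in>S. \<forall>c\<in>S. \<forall>d\<in>S.
     f a < f b \<longrightarrow> f b < f c \<longrightarrow> f c < f d \<longrightarrow> \<not> (E a c \<and> E b d))"

section \<open>Gluing vertex orders along components and cut vertices\<close>

lemma noncrossing_on_disjoint_union:
  assumes f: "inj_on f A" "noncrossing_on E f A" and g: "inj_on g B" "noncrossing_on E g B"
    and "finite A" and E: "symp E" "\<And>x y. x \<in> A \<Longrightarrow> y \<in> B \<Longrightarrow> \<not> E x y" and AB: "A \<inter> B = {}"
  shows "\<exists>h. inj_on h (A \<union> B) \<and> (\<forall>x\<in>A. h x = f x) \<and> noncrossing_on E h (A \<union> B)"
proof -
  define N where "N = Suc (Max (insert 0 (f ` A)))"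
  have N: "f x < N" if "x \<in> A" for x
    unfolding N_def using assms(5) that by (intro le_imp_less_Suc Max_ge) auto
  define h where "h x = (if x \<in> A then f x else N + g x)" for x
  have hA: "h x = f x" if "x \<in> A" for x using that by (simp add: h_def)
  have hB: "h x = N + g x" if "x \<in> B" for x using that AB by (auto simp: h_def)
  have "inj_on h (A \<union> B)"
  proof (rule inj_onI)
    fix x y assume xy: "x \<in> A \<union> B" "y \<in> A \<union> B" "h x = h y"
    then consider "x \<in> A" "y \<in> A" | "x \<in> A" "y \<in> B" | "x \<in> B" "y \<in> A" | "x \<in> B" "y \<in> B" by blast
    then show "x = y"
    proof cases
      case 1 then show ?thesis using xy(3) f(1) hA[OF 1(1)] hA[OF 1(2)] by (metis inj_onD)
    next
      case 2 then show ?thesis using xy(3) N[OF 2(1)] hA[OF 2(1)] hB[OF 2(2)] by linarith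
    next
      case 3 then show ?thesis using xy(3) N[OF 3(2)] hA[OF 3(2)] hB[OF 3(1)] by linarith
    next
      case 4 then show ?thesis using xy(3) g(1) hB[OF 4(1)] hB[OF 4(2)] by (metis add_left_cancel inj_onD)
    qed
  qed
  moreover have "noncrossing_on E h (A \<union> B)"
    unfolding noncrossing_on_def
  proof (intro ballI impI notI)
    fix a b c d assume m: "a \<in> A \<union> B" "b \<in> A \<union> B" "c \<in> A \<union> B" "d \<in> A \<union> B"
      and o: "h a < h b" "h b < h c" "h c < h d" and e: "E a c \<and> E b d"
    have side: "x \<in> A \<and> y \<in> A \<or> x \<in> B \<and> y \<in> B" if "x \<in> A \<union> B" "y \<in> A \<union> B" "E x y" for x y
      using that E by (auto dest: sympD)
    from side[OF m(1,3)] side[OF m(2,4)] e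
    consider "a \<in> A" "c \<in> A" "b \<in> A" "d \<in> A" | "a \<in> A" "c \<in> A" "b \<in> B" "d \<in> B"
      | "a \<in> B" "c \<in> B" "b \<in> A" "d \<in> A" | "a \<in> B" "c \<in> B" "b \<in> B" "d \<in> B" by blast
    then show False
    proof cases
      case 1
      then have "f a < f b" "f b < f c" "f c < f d" using o by (simp_all only: hA)
      then show False using f(2) 1 e unfolding noncrossing_on_def by blast
    next
      case 2 then show False using o N[of c] by (simp add: hA hB)
    next
      case 3 then show False using o N[of b] by (simp add: hA hB)
    next
      case 4
      then have "g a < g b" "g b < g c" "g c < g d" using o by (simp_all only: hB)
      then show False using g(2) 4 e unfolding noncrossing_on_def by blast
    qed
  qed
  ultimately show ?thesis using hA by blast
qed

text \<open>All of \<open>B\<close> goes directly behind \<open>v\<close>: \<open>f\<close> is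
  stretched by a strict upper bound \<open>M\<close> of \<open>g\<close>, and \<open>g\<close>,
  which starts with \<open>v\<close>, fills the block of length \<open>M\<close> opening at
  \<open>v\<close>. Keeping the value 0 lets a prescribed first vertex survive the gluing.\<close>

lemma noncrossing_on_cutvertex_union:
  assumes f: "inj_on f (insert v A)" "noncrossing_on E f (insert v A)"
    and g: "inj_on g (insert v B)" "noncrossing_on E g (insert v B)" "g v = 0"
    and "finite B" and E: "symp E" "\<And>x y. x \<in> A \<Longrightarrow> y \<in> B \<Longrightarrow> \<not> E x y"
    and AB: "A \<inter> B = {}" "v \<notin> A" "v \<notin> B"
  shows "\<exists>h. inj_on h (insert v (A \<union> B)) \<and> (\<forall>x\<in>insert v A. f x = 0 \<longrightarrow> h x = 0) \<and>
    noncrossing_on E h (insert v (A \<union> B))"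
proof -
  define M where "M = Suc (Max (insert 0 (g ` B)))"
  have M: "g x < M" if "x \<in> insert v B" for x
    unfolding M_def using assms(6) that g(3) by (intro le_imp_less_Suc Max_ge) auto
  have M0: "0 < M" by (simp add: M_def)
  define h where "h x = (if x \<in> insert v A then f x * M else f v * M + g x)" for x
  have hA: "h x = f x * M" if "x \<in> insert v A" for x using that by (simp add: h_def)
  have hB: "h x = f v * M + g x" if "x \<in> insert v B" for x using that AB g(3) by (auto simp: h_def)
  have hBv: "h v \<le> h x" "h x < (f v + 1) * M" if "x \<in> insert v B" for x
    using that M[of x] by (auto simp: hB g(3))
  \<comment> \<open>Stretched values are multiples of \<open>M\<close>, and the half-open block
    contains only one of them.\<close>
  have block: "x = v" if x: "x \<in> insert v A" "h v \<le> h x" "h x < (f v + 1) * M" for x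
  proof -
    have "f v * M \<le> f x * M" "f x * M < (f v + 1) * M" using x hA[of x] hA[of v] by auto
    then have "f v \<le> f x" "f x < f v + 1" using M0 by (metis mult_le_cancel2, metis mult_less_cancel2)
    then have "f x = f v" by simp
    then show ?thesis using f(1) x(1) by (auto simp: inj_on_def)
  qed
  have "inj_on h (insert v (A \<union> B))"
  proof (rule inj_onI)
    fix x y assume xy: "x \<in> insert v (A \<union> B)" "y \<in> insert v (A \<union> B)" "h x = h y"
    have mixed: "x = y" if "x \<in> insert v A" "y \<in> insert v B" "h x = h y" for x y
    proof -
      have "x = v" using block[OF that(1)] hBv[OF that(2)] that(3) by simp
      then have "g y = g v" using that hB[of y] hB[of v] by simp
      then show ?thesis using g(1) that \<open>x = v\<close> by (auto simp: inj_on_def)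
    qed
    consider "x \<in> insert v A" "y \<in> insert v A" | "x \<in> insert v B" "y \<in> insert v B"
      | "x \<in> insert v A" "y \<in> insert v B" | "x \<in> insert v B" "y \<in> insert v A" using xy by blast
    then show "x = y"
    proof cases
      case 1 then show ?thesis using xy(3) M0 f(1) by (auto simp: hA inj_on_def)
    next
      case 2 then show ?thesis using xy(3) hB[OF 2(1)] hB[OF 2(2)] g(1) by (auto simp: inj_on_def)
    next
      case 3 then show ?thesis using mixed xy(3) by blast
    next
      case 4 then show ?thesis using mixed[of y x] xy(3) by simp
    qed
  qed
  moreover have "noncrossing_on E h (insert v (A \<union> B))"
    unfolding noncrossing_on_def
  proof (intro ballI impI notI)
    fix a b c d assume m: "a \<in> insert v (A \<union> B)" "b \<in> insert v (A \<union> B)" "c \<in> insert v (A \<union> B)"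
      "d \<in> insert v (A \<union> B)"
      and o: "h a < h b" "h b < h c" "h c < h d" and e: "E a c \<and> E b d"
    have side: "x \<in> insert v A \<and> y \<in> insert v A \<or> x \<in> insert v B \<and> y \<in> insert v B"
      if "x \<in> insert v (A \<union> B)" "y \<in> insert v (A \<union> B)" "E x y" for x y
      using that E by (auto dest: sympD)
    from side[OF m(1,3)] side[OF m(2,4)] e
    consider "a \<in> insert v A" "c \<in> insert v A" "b \<in> insert v A" "d \<in> insert v A"
      | "a \<in> insert v A" "c \<in> insert v A" "b \<in> insert v B" "d \<in> insert v B"
      | "a \<in> insert v B" "c \<in> insert v B" "b \<in> insert v A" "d \<in> insert v A"
      | "a \<in> insert v B" "c \<in> insert v B" "b \<in> insert v B" "d \<in> insert v B" by blast
    then show False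
    proof cases
      case 1
      then have "f a < f b" "f b < f c" "f c < f d" using o M0 by (simp_all only: hA mult_less_cancel2)
      then show False using f(2) 1 e unfolding noncrossing_on_def by blast
    next
      case 2
      have "c = v" using block[OF 2(2)] hBv[OF 2(3)] hBv[OF 2(4)] o by simp
      then show False using hBv(1)[OF 2(3)] o by simp
    next
      case 3
      have "b = v" using block[OF 3(3)] hBv[OF 3(1)] hBv[OF 3(2)] o by simp
      then show False using hBv(1)[OF 3(1)] o by simp
    next
      case 4
      then have "g a < g b" "g b < g c" "g c < g d" using o by (simp_all only: hB)
      then show False using g(2) 4 e unfolding noncrossing_on_def by blast
    qed
  qed
  moreover have "\<forall>x\<in>insert v A. f x = 0 \<longrightarrow> h x = 0" by (simp add: hA)
  ultimately show ?thesis by blast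
qed

section \<open>Hamiltonian cycles in blocks and their chords\<close>

definition separates :: "('a \<Rightarrow> 'a \<Rightarrow> bool) \<Rightarrow> 'a set \<Rightarrow> 'a set \<Rightarrow> bool" where
  "separates E A B \<longleftrightarrow> A \<noteq> {} \<and> B \<noteq> {} \<and> A \<inter> B = {} \<and> (\<forall>x\<in>A. \<forall>y\<in>B. \<not> E x y)"

text \<open>Take a longest cycle. If it misses a vertex, an edge leaves it at some \<open>a\<close>;
  as \<open>a\<close> is no cut vertex, the component reached by this edge returns to the cycle at
  another vertex \<open>y\<close>. If \<open>a\<close> and \<open>y\<close> are neighbours on the
  cycle, the detour replaces their edge and gives a longer cycle; otherwise it forms an excluded
  theta with the two arcs of the cycle.\<close>

lemma hamiltonian_graph_cycle:
  assumes "finite S" "card S \<ge> 2" and sym: "symp E" and irr: "irreflp E"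
    and conn: "\<And>A B. A \<union> B = S \<Longrightarrow> \<not> separates E A B"
    and nocut: "\<And>v A B. v \<in> S \<Longrightarrow> A \<union> B = S - {v} \<Longrightarrow> \<not> separates E A B"
    and no_theta: "\<And>a b xs ys zs. \<lbrakk>distinct (a # b # xs @ ys @ zs); set (a # b # xs @ ys @ zs) \<subseteq> S;
       xs \<noteq> []; ys \<noteq> []; zs \<noteq> []; successively E (a # xs @ [b]); successively E (a # ys @ [b]);
       successively E (a # zs @ [b])\<rbrakk> \<Longrightarrow> False"
  obtains c where "graph_cycle E c" "set c = S"
proof -
  let ?C = "\<lambda>c. graph_cycle E c \<and> set c \<subseteq> S"
  have bound: "length c \<le> card S" if "?C c" for c
    using that assms(1) by (metis card_mono distinct_card graph_cycle_def)
  obtain x where x: "x \<in> S" using assms(2) by fastforce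
  have "S - {x} \<noteq> {}"
  proof
    assume "S - {x} = {}"
    then have "S = {x}" using x by blast
    then show False using assms(2) by simp
  qed
  then obtain y where "y \<in> S" "E x y"
    using conn[of "{x}" "S - {x}"] x unfolding separates_def by auto
  moreover then have "x \<noteq> y" using irr by (auto simp: irreflp_def)
  ultimately have "?C [x, y]"
    using x sym unfolding graph_cycle_def by (auto dest: sympD)
  then obtain c where c: "?C c" and cmax: "\<And>d. ?C d \<Longrightarrow> length d \<le> length c"
    using ex_has_greatest_nat[of ?C "[x, y]" length "Suc (card S)"] bound less_Suc_eq_le by blast
  have "set c = S"
  proof (rule ccontr)
    assume "set c \<noteq> S"
    have len: "2 \<le> length c" "distinct c" using c unfolding graph_cycle_def by auto
    then have "set c \<noteq> {}" by auto
    then have "\<not> (\<forall>x\<in>set c. \<forall>y\<in>S - set c. \<not> E x y)"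
      using conn[of "set c" "S - set c"] c \<open>set c \<noteq> S\<close> unfolding separates_def by blast
    then obtain a w where a: "a \<in> set c" and w: "w \<in> S - set c" "E a w" by blast
    define W where "W = {x. (\<lambda>u v. u \<in> S - set c \<and> v \<in> S - set c \<and> E u v)\<^sup>*\<^sup>* w x}"
    have WS: "x \<in> S - set c" if "x \<in> W" for x
      using that w unfolding W_def by (auto elim: rtranclp.cases)
    have "w \<in> W" by (simp add: W_def)
    have "card (set c) \<ge> 2" using len by (simp add: distinct_card)
    have "set c - {a} \<noteq> {}"
    proof
      assume "set c - {a} = {}"
      then have "set c = {a}" using a by blast
      then show False using \<open>card (set c) \<ge> 2\<close> by simp
    qed
    then have "S - {a} - W \<noteq> {}" using WS c by blast
    moreover have "W \<union> (S - {a} - W) = S - {a}" using WS a by blast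
    moreover have "a \<in> S" using a c by blast
    ultimately have "\<not> (\<forall>x\<in>W. \<forall>y\<in>S - {a} - W. \<not> E x y)"
      using nocut[of a W "S - {a} - W"] \<open>w \<in> W\<close> unfolding separates_def by blast
    then obtain x y where x: "x \<in> W" and y: "y \<in> S - {a} - W" "E x y" by blast
    have "y \<in> set c"
    proof (rule ccontr)
      assume "y \<notin> set c"
      then have "y \<in> W"
        using x y WS[OF x] unfolding W_def by (auto intro: rtranclp.rtrancl_into_rtrancl)
      then show False using y by blast
    qed
    obtain zs where zs: "zs \<noteq> []" "hd zs = w" "last zs = x" "distinct zs" "set zs \<subseteq> S - set c" "successively E zs"
      using rtranclp_imp_distinct_path[of "S - set c" E w x] x w unfolding W_def by blast
    obtain p q where "c = p @ a # q" using a by (meson split_list)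
    then have cyc: "graph_cycle E (a # q @ p)" and setc: "set (a # q @ p) = set c"
      and lenc: "length (a # q @ p) = length c"
      using graph_cycle_rotate[of E p "a # q"] c by auto
    have "y \<in> set (q @ p)" using \<open>y \<in> set c\<close> y setc by auto
    then obtain c1 c2 where c12: "q @ p = c1 @ y # c2" by (meson split_list)
    have cyc': "graph_cycle E (a # c1 @ y # c2)" and setc': "set (a # c1 @ y # c2) = set c"
      and lenc': "length (a # c1 @ y # c2) = length c"
      using cyc setc lenc c12 by auto
    note paths = graph_cycle_path[OF cyc' sym]
    have ear: "successively E (a # zs @ [y])"
      using zs w y by (auto simp: successively_append_iff successively_Cons)
    have dz: "distinct (a # zs @ y # c2)" "distinct (a # c1 @ y # rev zs)"
      "distinct (a # y # c1 @ rev c2 @ zs)"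
      using paths(3) zs(4,5) setc' by auto
    have Ela: "E (last (y # c2)) a" using cyc' unfolding graph_cycle_def by auto
    have Sub: "set (a # c1 @ y # c2) \<subseteq> S" "set zs \<subseteq> S" using setc' c zs(5) by auto
    show False
    proof (cases "c1 = [] \<or> c2 = []")
      case True
      then have "\<exists>d. ?C d \<and> length d > length c"
      proof
        assume c1: "c1 = []"
        have "successively E (y # c2)"
          using cyc' c1 unfolding graph_cycle_def by (auto simp: successively_Cons)
        then have "graph_cycle E (a # zs @ y # c2)"
          using ear dz Ela zs(1) unfolding graph_cycle_def by (auto simp: successively_append_iff successively_Cons)
        moreover obtain n where "length zs = Suc n" using zs(1) by (cases zs) auto
        ultimately show ?thesis using lenc' c1 Sub by (intro exI[of _ "a # zs @ y # c2"]) auto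
      next
        assume c2: "c2 = []"
        have "successively E (y # rev zs @ [a])"
          using ear successively_rev_sym[OF sym, of "a # zs @ [y]"] by simp
        then have "successively E ((a # c1) @ (y # rev zs))" "E (last (y # rev zs)) a"
          using paths(1) zs(1) unfolding successively_append_iff by (auto simp: successively_append_iff successively_Cons)
        then have "graph_cycle E (a # c1 @ y # rev zs)"
          using dz unfolding graph_cycle_def by auto
        moreover obtain n where "length zs = Suc n" using zs(1) by (cases zs) auto
        ultimately show ?thesis using lenc' c2 Sub by (intro exI[of _ "a # c1 @ y # rev zs"]) auto
      qed
      then show False using cmax by (meson not_less)
    next
      case False
      then show False
        using no_theta[OF dz(3) _ _ _ zs(1) paths(1,2) ear] Sub by auto
    qed
  qed
  with c that show ?thesis by blast
qed

text \<open>Number the vertices along the cycle, starting at \<open>v\<close>. The ends of one chord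
  divide the cycle into two paths, and a chord crossing it joins inner vertices of these two
  paths.\<close>

lemma noncrossing_on_graph_cycle:
  assumes c: "graph_cycle E c" and sym: "symp E" and v: "v \<in> set c"
    and no_cross: "\<And>a b xs ys x y. \<lbrakk>distinct (a # b # xs @ ys); set (a # b # xs @ ys) \<subseteq> set c;
       successively E (a # xs @ [b]); successively E (a # ys @ [b]); E a b; x \<in> set xs; y \<in> set ys; E x y\<rbrakk> \<Longrightarrow> False"
  shows "\<exists>f. inj_on f (set c) \<and> f v = 0 \<and> noncrossing_on E f (set c)"
proof -
  obtain p q where "c = p @ v # q" using v by (meson split_list)
  define d where "d = v # q @ p"
  have d: "graph_cycle E d" "set d = set c"
    using graph_cycle_rotate[of E p "v # q"] c \<open>c = p @ v # q\<close> unfolding d_def by auto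
  define f where "f = inv_into {..<length d} ((!) d)"
  have inj: "inj_on ((!) d) {..<length d}"
    using d(1) unfolding graph_cycle_def by (auto simp: inj_on_def nth_eq_iff_index_eq)
  have f: "f x < length d" "d ! f x = x" if "x \<in> set d" for x
  proof -
    have "x \<in> (!) d ` {..<length d}" using that by (auto simp: in_set_conv_nth)
    then show "f x < length d" "d ! f x = x"
      unfolding f_def using inv_into_into[of x "(!) d" "{..<length d}"] f_inv_into_f[of x "(!) d" "{..<length d}"] by auto
  qed
  have "f (d ! 0) = 0"
    unfolding f_def by (rule inv_into_f_f[OF inj]) (simp add: d_def)
  then have "f v = 0" by (simp add: d_def)
  moreover have "inj_on f (set c)"
    using f d(2) by (metis inj_onI)
  moreover have "noncrossing_on E f (set c)"
    unfolding noncrossing_on_def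
  proof (intro ballI impI notI)
    fix x1 x2 x3 x4 assume m: "x1 \<in> set c" "x2 \<in> set c" "x3 \<in> set c" "x4 \<in> set c"
      and o: "f x1 < f x2" "f x2 < f x3" "f x3 < f x4" and e: "E x1 x3 \<and> E x2 x4"
    note m' = m[folded d(2)]
    have "f x1 < f x3" using o by simp
    then obtain r xs s where s: "d = r @ d ! f x1 # xs @ d ! f x3 # s" "length r = f x1"
      "length r + length xs + 1 = f x3" using list_split_two f(1)[OF m'(3)] by metis
    then have ds: "d = r @ x1 # xs @ x3 # s" using f m' by simp
    \<comment> \<open>In \<open>d\<close> the list \<open>xs\<close> is preceded by the
      \<open>f x1\<close> entries of \<open>r\<close> and by \<open>x1\<close>, which accounts for
      the shift by one.\<close>
    have "f x2 - f x1 - 1 < length xs" using o s(2,3) by linarith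
    moreover have "d ! f x2 = xs ! (f x2 - f x1 - 1)"
      using o s(2,3) by (subst ds) (auto simp: nth_append nth_Cons')
    ultimately have x2: "x2 \<in> set xs" using f(2)[OF m'(2)] by (metis nth_mem)
    have "f x4 < length r + length xs + 2 + length s"
      using f(1)[OF m'(4)] arg_cong[OF ds, of length] by simp
    then have "f x4 - f x3 - 1 < length s" using o s(2,3) by linarith
    moreover have "d ! f x4 = s ! (f x4 - f x3 - 1)"
      using o s(2,3) by (subst ds) (auto simp: nth_append nth_Cons')
    ultimately have x4: "x4 \<in> set s" using f(2)[OF m'(4)] by (metis nth_mem)
    have cyc: "graph_cycle E (x1 # xs @ x3 # (s @ r))"
      using graph_cycle_rotate[of E r "x1 # xs @ x3 # s"] d(1) ds by simp
    show False
    proof (rule no_cross)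
      show "distinct (x1 # x3 # xs @ rev (s @ r))" "successively E (x1 # xs @ [x3])"
        "successively E (x1 # rev (s @ r) @ [x3])" using graph_cycle_path[OF cyc sym] by auto
      show "set (x1 # x3 # xs @ rev (s @ r)) \<subseteq> set c" using arg_cong[OF ds, of set] d(2) by auto
    qed (use e x2 x4 in auto)
  qed
  ultimately show ?thesis by blast
qed

text \<open>The first vertex is prescribed because a cut vertex has to come first in the part that
  is inserted behind it. Both exclusions speak of configurations within \<open>S\<close> and so pass
  to the smaller sets of the induction.\<close>

lemma exists_noncrossing_on:
  assumes "finite S" "v \<in> S" and sym: "symp E" and irr: "irreflp E"
    and no_theta: "\<And>a b xs ys zs. \<lbrakk>distinct (a # b # xs @ ys @ zs); set (a # b # xs @ ys @ zs) \<subseteq> S;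
       xs \<noteq> []; ys \<noteq> []; zs \<noteq> []; successively E (a # xs @ [b]); successively E (a # ys @ [b]);
       successively E (a # zs @ [b])\<rbrakk> \<Longrightarrow> False"
    and no_cross: "\<And>a b xs ys x y. \<lbrakk>distinct (a # b # xs @ ys); set (a # b # xs @ ys) \<subseteq> S;
       successively E (a # xs @ [b]); successively E (a # ys @ [b]); E a b; x \<in> set xs; y \<in> set ys; E x y\<rbrakk> \<Longrightarrow> False"
  shows "\<exists>f. inj_on f S \<and> f v = 0 \<and> noncrossing_on E f S"
  using assms(1,2) no_theta no_cross
proof (induction "card S" arbitrary: S v rule: less_induct)
  case less
  have IH: "\<exists>f. inj_on f A \<and> f u = 0 \<and> noncrossing_on E f A" if "A \<subset> S" "u \<in> A" for A u
  proof (rule less.hyps)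
    show "card A < card S" using that less.prems(1) by (simp add: psubset_card_mono)
    show "finite A" using that less.prems(1) finite_subset by blast
    show "u \<in> A" by fact
    fix a b xs ys zs
    assume "distinct (a # b # xs @ ys @ zs)" "set (a # b # xs @ ys @ zs) \<subseteq> A"
       "xs \<noteq> []" "ys \<noteq> []" "zs \<noteq> []" "successively E (a # xs @ [b])" "successively E (a # ys @ [b])"
       "successively E (a # zs @ [b])"
    then show False using psubset_imp_subset[OF that(1)] by (intro less.prems(3)[of a b xs ys zs]) blast+
  next
    fix a b xs ys x y
    assume "distinct (a # b # xs @ ys)" "set (a # b # xs @ ys) \<subseteq> A"
       "successively E (a # xs @ [b])" "successively E (a # ys @ [b])" "E a b" "x \<in> set xs" "y \<in> set ys" "E x y"
    then show False using psubset_imp_subset[OF that(1)] by (intro less.prems(4)[of a b xs ys x y]) blast+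
  qed
  have sep_sym: "separates E B A" if "separates E A B" for A B
    using that sym unfolding separates_def by (auto dest: sympD)
  consider A B where "A \<union> B = S" "separates E A B" "v \<in> A"
    | w A B where "w \<in> S" "A \<union> B = S - {w}" "separates E A B" "v \<in> insert w A"
    | "card S = 1"
    | "card S \<ge> 2" "\<And>A B. A \<union> B = S \<Longrightarrow> \<not> separates E A B"
      "\<And>w A B. w \<in> S \<Longrightarrow> A \<union> B = S - {w} \<Longrightarrow> \<not> separates E A B"
  proof -
    note alt = that
    have "card S \<noteq> 0" using less.prems by auto
    then have "card S = 1 \<or> card S \<ge> 2" by linarith
    moreover have thesis if w: "A \<union> B = S" "separates E A B" for A B
    proof (cases "v \<in> A")
      case False
      then have "v \<in> B" "B \<union> A = S" using w(1) less.prems(2) by auto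
      then show thesis using sep_sym[OF w(2)] by (intro alt(1)[of B A])
    qed (rule alt(1)[OF w])
    moreover have thesis if w: "w \<in> S" "A \<union> B = S - {w}" "separates E A B" for w A B
    proof (cases "v \<in> insert w A")
      case False
      then have "v \<in> insert w B" "B \<union> A = S - {w}" using w(2) less.prems(2) by auto
      then show thesis using sep_sym[OF w(3)] w(1) by (intro alt(2)[of w B A])
    qed (rule alt(2)[OF w])
    ultimately show thesis using alt(3,4) by blast
  qed
  then show ?case
  proof cases
    case (1 A B)
    have "A \<subset> S" "B \<subset> S" using 1 unfolding separates_def by blast+
    obtain u where "u \<in> B" using 1(2) unfolding separates_def by blast
    obtain f where f: "inj_on f A" "f v = 0" "noncrossing_on E f A"
      using IH[OF \<open>A \<subset> S\<close> 1(3)] by blast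
    obtain g where g: "inj_on g B" "noncrossing_on E g B"
      using IH[OF \<open>B \<subset> S\<close> \<open>u \<in> B\<close>] by blast
    have "finite A"
      using finite_subset[OF psubset_imp_subset[OF \<open>A \<subset> S\<close>] less.prems(1)] .
    then have "\<exists>h. inj_on h (A \<union> B) \<and> (\<forall>x\<in>A. h x = f x) \<and> noncrossing_on E h (A \<union> B)"
      using 1(2) by (intro noncrossing_on_disjoint_union[OF f(1,3) g _ sym]) (auto simp: separates_def)
    then show ?thesis using 1(1,3) f(2) by auto
  next
    case (2 w A B)
    have "insert w A \<subset> S" "insert w B \<subset> S" "w \<notin> A" "w \<notin> B" using 2 unfolding separates_def by blast+
    obtain f where f: "inj_on f (insert w A)" "f v = 0" "noncrossing_on E f (insert w A)"
      using IH[OF \<open>insert w A \<subset> S\<close> 2(4)] by blast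
    obtain g where g: "inj_on g (insert w B)" "g w = 0" "noncrossing_on E g (insert w B)"
      using IH[OF \<open>insert w B \<subset> S\<close>, of w] by blast
    have "finite B"
      using finite_subset[OF psubset_imp_subset[OF \<open>insert w B \<subset> S\<close>] less.prems(1)] by simp
    have "insert w (A \<union> B) = S" using 2 by blast
    moreover have "\<exists>h. inj_on h (insert w (A \<union> B)) \<and> (\<forall>x\<in>insert w A. f x = 0 \<longrightarrow> h x = 0) \<and>
        noncrossing_on E h (insert w (A \<union> B))"
      using 2(3)
      by (intro noncrossing_on_cutvertex_union[OF f(1,3) g(1,3,2) \<open>finite B\<close> sym _ _ \<open>w \<notin> A\<close> \<open>w \<notin> B\<close>])
         (auto simp: separates_def)
    ultimately show ?thesis using 2(4) f(2) by auto
  next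
    case 3
    then obtain u where "S = {u}" by (auto simp: card_1_singleton_iff)
    then show ?thesis using less.prems(2)
      by (intro exI[of _ "\<lambda>_. 0"]) (auto simp: noncrossing_on_def)
  next
    case 4
    obtain c where "graph_cycle E c" "set c = S"
      by (rule hamiltonian_graph_cycle[OF less.prems(1) 4(1) sym irr 4(2,3) less.prems(3)])
    have "\<exists>f. inj_on f (set c) \<and> f v = 0 \<and> noncrossing_on E f (set c)"
    proof (rule noncrossing_on_graph_cycle[OF \<open>graph_cycle E c\<close> sym])
      show "v \<in> set c" using less.prems(2) \<open>set c = S\<close> by simp
    qed (use less.prems(4) \<open>set c = S\<close> in blast)
    then show ?thesis using \<open>set c = S\<close> by simp
  qed
qed

section \<open>Theta curves in outerplanar drawings\<close>

lemma connected_inside_or_outside: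
  assumes "connected T" "T \<inter> C = {}"
  shows "T \<subseteq> inside C \<or> T \<subseteq> outside C"
proof -
  have "inside C \<inter> T = {} \<or> outside C \<inter> T = {}"
    using inside_outside_intersect_connected[OF assms(1), of C] assms(2) by blast
  moreover have "inside C \<union> outside C = - C" by (rule inside_Un_outside)
  ultimately show ?thesis using assms(2) by blast
qed

lemma Jordan_two_arcs:
  fixes c1 c2 :: "real \<Rightarrow> complex"
  assumes "arc c1" "pathstart c1 = a" "pathfinish c1 = b"
    and "arc c2" "pathstart c2 = a" "pathfinish c2 = b"
    and "path_image c1 \<inter> path_image c2 = {a, b}"
  shows "inside (path_image c1 \<union> path_image c2) \<noteq> {}"
    "connected (inside (path_image c1 \<union> path_image c2))"
    "connected (outside (path_image c1 \<union> path_image c2))"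
    "frontier (inside (path_image c1 \<union> path_image c2)) = path_image c1 \<union> path_image c2"
proof -
  let ?c = "c1 +++ reversepath c2"
  have sp: "simple_path ?c"
    using assms by (intro simple_path_join_loop) (auto simp: arc_reversepath)
  have im: "path_image ?c = path_image c1 \<union> path_image c2"
    using assms by (simp add: path_image_join)
  have "pathfinish ?c = pathstart ?c" using assms by simp
  note J = Jordan_inside_outside[OF sp this, unfolded im]
  from J show "inside (path_image c1 \<union> path_image c2) \<noteq> {}"
    "connected (inside (path_image c1 \<union> path_image c2))"
    "connected (outside (path_image c1 \<union> path_image c2))"
    "frontier (inside (path_image c1 \<union> path_image c2)) = path_image c1 \<union> path_image c2"
    by auto
qed

lemma arc_endless_nonempty:
  assumes "arc c" shows "path_image c - {pathstart c, pathfinish c} \<noteq> {}"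
proof -
  have "c (1/2) \<noteq> c 0" "c (1/2) \<noteq> c 1"
    using assms unfolding arc_def inj_on_def by force+
  moreover have "c (1/2) \<in> path_image c" by (simp add: path_image_def)
  ultimately show ?thesis unfolding pathstart_def pathfinish_def by blast
qed

lemma inside_disjoint_outer_arc:
  assumes "path_image c3 - {a, b} \<subseteq> outside (P1 \<union> P2)" "a \<in> P1" "b \<in> P1"
  shows "inside (P1 \<union> P2) \<inter> path_image c3 = {}"
proof -
  have "inside (P1 \<union> P2) \<inter> outside (P1 \<union> P2) = {}" by (rule inside_Int_outside)
  moreover have "inside (P1 \<union> P2) \<inter> (P1 \<union> P2) = {}" by (rule inside_no_overlap)
  ultimately show ?thesis using assms by blast
qed

text \<open>Otherwise each open arc is outside the curve formed by the other two, and the three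
  insides are different faces. A point \<open>w\<close> inside the first curve is then outside the
  other two, like a point \<open>u\<close> outside all three arcs. Janiszewski's theorem joins
  \<open>u\<close> to \<open>w\<close> off all the arcs, although the first curve encloses
  \<open>w\<close>.\<close>

lemma theta_arc_inside:
  fixes c1 c2 c3 :: "real \<Rightarrow> complex"
  assumes c1: "arc c1" "pathstart c1 = a" "pathfinish c1 = b"
    and c2: "arc c2" "pathstart c2 = a" "pathfinish c2 = b"
    and c3: "arc c3" "pathstart c3 = a" "pathfinish c3 = b"
    and I12: "path_image c1 \<inter> path_image c2 = {a, b}"
    and I13: "path_image c1 \<inter> path_image c3 = {a, b}"
    and I23: "path_image c2 \<inter> path_image c3 = {a, b}"
  shows "path_image c1 - {a, b} \<subseteq> inside (path_image c2 \<union> path_image c3) \<or>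
    path_image c2 - {a, b} \<subseteq> inside (path_image c1 \<union> path_image c3) \<or>
    path_image c3 - {a, b} \<subseteq> inside (path_image c1 \<union> path_image c2)"
proof (rule ccontr)
  assume neg: "\<not> ?thesis"
  let ?P1 = "path_image c1" and ?P2 = "path_image c2" and ?P3 = "path_image c3"
  have conn: "connected (?P1 - {a, b})" "connected (?P2 - {a, b})" "connected (?P3 - {a, b})"
    using connected_simple_path_endless[OF arc_imp_simple_path[OF c1(1)]]
      connected_simple_path_endless[OF arc_imp_simple_path[OF c2(1)]]
      connected_simple_path_endless[OF arc_imp_simple_path[OF c3(1)]] c1 c2 c3 by simp_all
  have ab: "a \<in> ?P1" "b \<in> ?P1" "a \<in> ?P2" "b \<in> ?P2" "a \<in> ?P3" "b \<in> ?P3"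
    using I12 I13 by auto
  have "?P1 - {a, b} \<subseteq> outside (?P2 \<union> ?P3)"
    using connected_inside_or_outside[OF conn(1), of "?P2 \<union> ?P3"] neg I12 I13 by auto
  moreover have "?P2 - {a, b} \<subseteq> outside (?P1 \<union> ?P3)"
    using connected_inside_or_outside[OF conn(2), of "?P1 \<union> ?P3"] neg I12 I23 by auto
  moreover have "?P3 - {a, b} \<subseteq> outside (?P1 \<union> ?P2)"
    using connected_inside_or_outside[OF conn(3), of "?P1 \<union> ?P2"] neg I13 I23 by auto
  ultimately have d1: "inside (?P2 \<union> ?P3) \<inter> ?P1 = {}" and d2: "inside (?P1 \<union> ?P3) \<inter> ?P2 = {}"
    and d3: "inside (?P1 \<union> ?P2) \<inter> ?P3 = {}"
    using inside_disjoint_outer_arc[of c1 a b ?P2 ?P3] inside_disjoint_outer_arc[of c2 a b ?P1 ?P3]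
      inside_disjoint_outer_arc[of c3 a b ?P1 ?P2] ab by simp_all
  have ne: "?P1 - {a, b} \<noteq> {}" "?P2 - {a, b} \<noteq> {}"
    using arc_endless_nonempty[OF c1(1)] arc_endless_nonempty[OF c2(1)] c1 c2 by auto
  note J12 = Jordan_two_arcs[OF c1 c2 I12] and J13 = Jordan_two_arcs[OF c1 c3 I13]
    and J23 = Jordan_two_arcs[OF c2 c3 I23]
  obtain w where w: "w \<in> inside (?P1 \<union> ?P2)" using J12(1) by blast
  \<comment> \<open>Two distinct faces bounded by pairs of the arcs cannot overlap: both would be the same
    component of the complement of the theta curve, although their frontiers differ.\<close>
  have nolap: "x \<notin> inside Q" if Q: "connected (inside Q)" "frontier (inside Q) = Q" "Q \<noteq> ?P1 \<union> ?P2"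
    and dQ: "inside Q \<inter> (?P1 \<union> ?P2) = {}" and dP: "inside (?P1 \<union> ?P2) \<inter> Q = {}"
    and x: "x \<in> inside (?P1 \<union> ?P2)" for x Q
  proof
    assume xQ: "x \<in> inside Q"
    have "inside Q \<subseteq> inside (?P1 \<union> ?P2)"
      using connected_inside_or_outside[OF Q(1) dQ] x xQ inside_Int_outside by blast
    moreover have "inside (?P1 \<union> ?P2) \<subseteq> inside Q"
      using connected_inside_or_outside[OF J12(2) dP] x xQ inside_Int_outside by blast
    ultimately have "inside Q = inside (?P1 \<union> ?P2)" by blast
    then show False using J12(4) Q(2,3) by simp
  qed
  have n0: "inside (?P1 \<union> ?P2) \<inter> (?P1 \<union> ?P2) = {}" "inside (?P1 \<union> ?P3) \<inter> (?P1 \<union> ?P3) = {}"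
    "inside (?P2 \<union> ?P3) \<inter> (?P2 \<union> ?P3) = {}" by (rule inside_no_overlap)+
  have "w \<notin> inside (?P1 \<union> ?P3)"
  proof (rule nolap[OF J13(2,4) _ _ _ w])
    show "?P1 \<union> ?P3 \<noteq> ?P1 \<union> ?P2" using ne(2) I12 I23 by blast
    show "inside (?P1 \<union> ?P3) \<inter> (?P1 \<union> ?P2) = {}" "inside (?P1 \<union> ?P2) \<inter> (?P1 \<union> ?P3) = {}"
      using n0 d2 d3 by blast+
  qed
  moreover have "w \<notin> ?P1 \<union> ?P3" "w \<notin> ?P2 \<union> ?P3" using w n0(1) d3 by blast+
  moreover have "w \<notin> inside (?P2 \<union> ?P3)"
  proof (rule nolap[OF J23(2,4) _ _ _ w])
    show "?P2 \<union> ?P3 \<noteq> ?P1 \<union> ?P2" using ne(1) I12 I13 by blast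
    show "inside (?P2 \<union> ?P3) \<inter> (?P1 \<union> ?P2) = {}" "inside (?P1 \<union> ?P2) \<inter> (?P2 \<union> ?P3) = {}"
      using n0 d1 d3 by blast+
  qed
  ultimately have wo: "w \<in> outside (?P1 \<union> ?P3)" "w \<in> outside (?P2 \<union> ?P3)"
    by (simp_all add: outside_inside)
  have "bounded (?P1 \<union> ?P2 \<union> ?P3)"
    using c1 c2 c3 by (simp add: bounded_arc_image)
  then obtain u where u: "u \<in> outside (?P1 \<union> ?P2 \<union> ?P3)"
    using outside_bounded_nonempty by blast
  have uo: "u \<in> outside (?P1 \<union> ?P2)" "u \<in> outside (?P1 \<union> ?P3)" "u \<in> outside (?P2 \<union> ?P3)"
    by (rule subsetD[OF outside_mono u], blast)+
  have "connected_component (- ((?P1 \<union> ?P3) \<union> (?P2 \<union> ?P3))) u w"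
  \<comment> \<open>The two curves are chosen to share exactly the arc \<open>?P3\<close>, so that
    their intersection is connected.\<close>
  proof (rule Janiszewski)
    show "compact (?P1 \<union> ?P3)" "closed (?P2 \<union> ?P3)"
      using c1 c2 c3 by (simp_all add: compact_Un compact_arc_image closed_Un closed_arc_image)
    have "(?P1 \<union> ?P3) \<inter> (?P2 \<union> ?P3) = (?P1 \<inter> ?P2) \<union> ?P3" by blast
    also have "\<dots> = ?P3" unfolding I12 using ab by auto
    finally have "(?P1 \<union> ?P3) \<inter> (?P2 \<union> ?P3) = ?P3" .
    then show "connected ((?P1 \<union> ?P3) \<inter> (?P2 \<union> ?P3))" using c3 by (simp add: connected_arc_image)
    show "connected_component (- (?P1 \<union> ?P3)) u w" "connected_component (- (?P2 \<union> ?P3)) u w"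
      unfolding connected_component_def using J13(3) J23(3) wo uo outside_no_overlap by blast+
  qed
  then obtain T where T: "connected T" "T \<subseteq> - ((?P1 \<union> ?P3) \<union> (?P2 \<union> ?P3))" "u \<in> T" "w \<in> T"
    unfolding connected_component_def by blast
  have "T \<inter> (?P1 \<union> ?P2) = {}" using T(2) by blast
  from connected_inside_or_outside[OF T(1) this] T(3,4) w uo(1) inside_Int_outside[of "?P1 \<union> ?P2"]
  show False by blast
qed

section \<open>Vertex lists as unions of edge arcs\<close>

fun walk_image :: "('a \<Rightarrow> 'a \<Rightarrow> real \<Rightarrow> complex) \<Rightarrow> 'a list \<Rightarrow> complex set" where
  "walk_image \<gamma> (u # v # p) = path_image (\<gamma> u v) \<union> walk_image \<gamma> (v # p)"
| "walk_image \<gamma> p = {}"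

lemma walk_image_append: "walk_image \<gamma> (p @ x # q) = walk_image \<gamma> (p @ [x]) \<union> walk_image \<gamma> (x # q)"
proof (induction p)
  case (Cons u p)
  then show ?case by (cases p) auto
qed simp

definition walk_edge :: "'a list \<Rightarrow> 'a \<Rightarrow> 'a \<Rightarrow> bool" where
  "walk_edge p x y \<longleftrightarrow> (\<exists>r s. p = r @ x # y # s)"

text \<open>Used to see that two internally disjoint paths with the same ends share an edge only if
  both consist of that edge.\<close>

lemma walk_edge_between_ends:
  assumes "distinct (a # xs @ [b])" "walk_edge (a # xs @ [b]) x y" "{x, y} \<subseteq> {a, b}"
  shows "xs = []"
proof -
  obtain r s where rs: "a # xs @ [b] = r @ x # y # s" using assms(2) unfolding walk_edge_def by blast
  have "distinct (r @ x # y # s)" using assms(1) rs by simp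
  then have "x \<noteq> y" by simp
  have "s = [] \<or> last s = b" "y = b \<longleftrightarrow> s = []"
    using arg_cong[OF rs, of last] \<open>distinct (r @ x # y # s)\<close> by (auto split: if_splits)
  moreover have "x = a \<longleftrightarrow> r = []"
    using arg_cong[OF rs, of hd] \<open>distinct (r @ x # y # s)\<close> by (cases r) auto
  moreover have "y \<noteq> a"
    using arg_cong[OF rs, of hd] \<open>distinct (r @ x # y # s)\<close> by (cases r) auto
  ultimately have "r = []" "s = []" using assms(3) \<open>x \<noteq> y\<close> by auto
  then show ?thesis using rs by simp
qed

context
  fixes V :: "'a set" and E pos and \<gamma> :: "'a \<Rightarrow> 'a \<Rightarrow> real \<Rightarrow> complex"
  assumes plane: "plane_embedding V E pos \<gamma>" and graph: "simple_graph V E"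
begin

lemma edge_vertices: "E u v \<Longrightarrow> u \<in> V" "E u v \<Longrightarrow> v \<in> V" "E u v \<Longrightarrow> u \<noteq> v" "E u v \<Longrightarrow> E v u"
  using graph unfolding simple_graph_def by auto

lemma edge_arc: "E u v \<Longrightarrow> arc (\<gamma> u v)" "E u v \<Longrightarrow> pathstart (\<gamma> u v) = pos u"
  "E u v \<Longrightarrow> pathfinish (\<gamma> u v) = pos v" "E u v \<Longrightarrow> path_image (\<gamma> v u) = path_image (\<gamma> u v)"
  using plane unfolding plane_embedding_def by auto

lemma edges_Int:
  "E u v \<Longrightarrow> E x y \<Longrightarrow> {u, v} \<noteq> {x, y} \<Longrightarrow> path_image (\<gamma> u v) \<inter> path_image (\<gamma> x y) \<subseteq> pos ` ({u, v} \<inter> {x, y})"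
  using plane unfolding plane_embedding_def by blast

lemma pos_in_edge: "E u v \<Longrightarrow> pos u \<in> path_image (\<gamma> u v)" "E u v \<Longrightarrow> pos v \<in> path_image (\<gamma> u v)"
  using edge_arc by (metis pathstart_in_path_image, metis pathfinish_in_path_image)

lemma pos_eq_iff: "u \<in> V \<Longrightarrow> v \<in> V \<Longrightarrow> pos u = pos v \<longleftrightarrow> u = v"
  using plane unfolding plane_embedding_def inj_on_def by auto

lemma walk_image_rev: "successively E p \<Longrightarrow> walk_image \<gamma> (rev p) = walk_image \<gamma> p"
proof (induction p rule: induct_list012)
  case (3 u v p)
  then have "walk_image \<gamma> (rev p @ [v]) = walk_image \<gamma> (v # p)" by simp
  with 3 show ?case
    using walk_image_append[of \<gamma> "rev p" v "[u]"] edge_arc(4)[of u v] by auto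
qed auto

lemma walk_edge_Int:
  assumes "successively E p" "E x y" "\<not> {x, y} \<subseteq> set p"
  shows "walk_image \<gamma> p \<inter> path_image (\<gamma> x y) \<subseteq> pos ` (set p \<inter> {x, y})"
  using assms(1,3)
proof (induction p rule: induct_list012)
  case (3 u v p)
  have "path_image (\<gamma> u v) \<inter> path_image (\<gamma> x y) \<subseteq> pos ` ({u, v} \<inter> {x, y})"
    using 3 by (intro edges_Int[OF _ assms(2)]) auto
  moreover have "walk_image \<gamma> (v # p) \<inter> path_image (\<gamma> x y) \<subseteq> pos ` (set (v # p) \<inter> {x, y})"
    using 3 by (intro 3(2)) auto
  ultimately show ?case by auto
qed auto

lemma walk_image_edge:
  assumes "successively E p" "z \<in> walk_image \<gamma> p"
  shows "\<exists>x y. E x y \<and> walk_edge p x y \<and> z \<in> path_image (\<gamma> x y)"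
  using assms
proof (induction p rule: induct_list012)
  case (3 u v p)
  show ?case
  proof (cases "z \<in> path_image (\<gamma> u v)")
    case True
    moreover have "walk_edge (u # v # p) u v" unfolding walk_edge_def by (metis append_Nil)
    ultimately show ?thesis using 3(3) by auto
  next
    case False
    then obtain x y where xy: "E x y" "walk_edge (v # p) x y" "z \<in> path_image (\<gamma> x y)" using 3 by auto
    have "walk_edge (u # v # p) x y" using xy(2) unfolding walk_edge_def by (metis append_Cons)
    with xy show ?thesis by blast
  qed
qed auto

lemma walks_Int:
  assumes "successively E p" "successively E q"
    and "\<And>x y. walk_edge p x y \<Longrightarrow> \<not> walk_edge q x y \<and> \<not> walk_edge q y x"
  shows "walk_image \<gamma> p \<inter> walk_image \<gamma> q \<subseteq> pos ` (set p \<inter> set q)"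
proof
  fix z assume z: "z \<in> walk_image \<gamma> p \<inter> walk_image \<gamma> q"
  obtain x y where 1: "E x y" "walk_edge p x y" "z \<in> path_image (\<gamma> x y)"
    using walk_image_edge[OF assms(1)] z by blast
  obtain u v where 2: "E u v" "walk_edge q u v" "z \<in> path_image (\<gamma> u v)"
    using walk_image_edge[OF assms(2)] z by blast
  have "{x, y} \<noteq> {u, v}"
    using assms(3)[OF 1(2)] 2(2) by (auto simp: doubleton_eq_iff)
  from edges_Int[OF 1(1) 2(1) this] 1 2 have "z \<in> pos ` ({x, y} \<inter> {u, v})" by blast
  moreover have "{x, y} \<subseteq> set p" "{u, v} \<subseteq> set q" using 1 2 by (auto simp: walk_edge_def)
  ultimately show "z \<in> pos ` (set p \<inter> set q)" by blast
qed

lemma pos_in_walk: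
  assumes "successively E p" "2 \<le> length p" "x \<in> set p"
  shows "pos x \<in> walk_image \<gamma> p"
  using assms
proof (induction p rule: induct_list012)
  case (3 u v p)
  have e: "pos u \<in> path_image (\<gamma> u v)" "pos v \<in> path_image (\<gamma> u v)"
    using pos_in_edge[of u v] 3(3) by auto
  show ?case
  proof (cases "x = u \<or> x = v")
    case False
    then have "x \<in> set p" using 3(5) by auto
    then have "2 \<le> length (v # p)" by (cases p) auto
    with 3 \<open>x \<in> set p\<close> show ?thesis by auto
  qed (use e in auto)
qed auto

text \<open>The first edge meets the rest only at their joint, because the vertices are distinct. A
  one-vertex list has empty image, hence the bound on the length.\<close>

lemma walk_arc:
  assumes "successively E p" "2 \<le> length p" "distinct p"
  shows "\<exists>g. arc g \<and> pathstart g = pos (hd p) \<and> pathfinish g = pos (last p) \<and> path_image g = walk_image \<gamma> p"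
  using assms
proof (induction p rule: induct_list012)
  case (3 u v p)
  have uv: "E u v" using 3(3) by simp
  show ?case
  proof (cases p)
    case Nil
    then show ?thesis using edge_arc[OF uv] by (intro exI[of _ "\<gamma> u v"]) auto
  next
    case (Cons w r)
    then obtain g where g: "arc g" "pathstart g = pos v" "pathfinish g = pos (last p)"
      "path_image g = walk_image \<gamma> (v # p)" using 3 by auto
    have "walk_image \<gamma> (v # p) \<inter> path_image (\<gamma> u v) \<subseteq> pos ` (set (v # p) \<inter> {u, v})"
      using 3 uv by (intro walk_edge_Int) auto
    also have "\<dots> \<subseteq> {pos v}" using 3(5) by auto
    finally have "arc (\<gamma> u v +++ g)"
      using g edge_arc[OF uv] by (intro arc_join) auto
    then show ?thesis using g edge_arc[OF uv] Cons
      by (intro exI[of _ "\<gamma> u v +++ g"]) (auto simp: path_image_join)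
  qed
qed auto

lemma walk_image_subset_drawing:
  "successively E p \<Longrightarrow> walk_image \<gamma> p \<subseteq> drawing V E pos \<gamma>"
proof (induction p rule: induct_list012)
  case (3 u v p)
  then have "path_image (\<gamma> u v) \<subseteq> drawing V E pos \<gamma>" unfolding drawing_def by fastforce
  with 3 show ?case by simp
qed auto

lemma compact_walk_image: "successively E p \<Longrightarrow> compact (walk_image \<gamma> p)"
proof (induction p rule: induct_list012)
  case (3 u v p)
  then show ?case using edge_arc(1)[of u v] by (auto intro!: compact_Un compact_arc_image)
qed auto

lemma paths_Int:
  assumes "distinct (a # b # xs @ ys)" "successively E (a # xs @ [b])" "successively E (a # ys @ [b])"
    and "xs \<noteq> [] \<or> ys \<noteq> []"
  shows "walk_image \<gamma> (a # xs @ [b]) \<inter> walk_image \<gamma> (a # ys @ [b]) = {pos a, pos b}"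
proof
  have "walk_image \<gamma> (a # xs @ [b]) \<inter> walk_image \<gamma> (a # ys @ [b]) \<subseteq>
      pos ` (set (a # xs @ [b]) \<inter> set (a # ys @ [b]))"
  proof (rule walks_Int[OF assms(2,3)])
    fix x y assume xy: "walk_edge (a # xs @ [b]) x y"
    have mem: "{u, v} \<subseteq> set p" if "walk_edge p u v" for p u v
      using that by (auto simp: walk_edge_def)
    show "\<not> walk_edge (a # ys @ [b]) x y \<and> \<not> walk_edge (a # ys @ [b]) y x"
    proof (rule ccontr)
      assume "\<not> ?thesis"
      then obtain u v where uv: "walk_edge (a # ys @ [b]) u v" "{u, v} = {x, y}" by blast
      have "{x, y} \<subseteq> {a, b}" using mem[OF xy] mem[OF uv(1)] uv(2) assms(1) by auto
      then have "xs = []" "ys = []"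
        using walk_edge_between_ends[OF _ xy] walk_edge_between_ends[OF _ uv(1)] uv(2) assms(1) by auto
      then show False using assms(4) by simp
    qed
  qed
  also have "set (a # xs @ [b]) \<inter> set (a # ys @ [b]) = {a, b}" using assms(1) by auto
  finally show "walk_image \<gamma> (a # xs @ [b]) \<inter> walk_image \<gamma> (a # ys @ [b]) \<subseteq> {pos a, pos b}" by simp
  show "{pos a, pos b} \<subseteq> walk_image \<gamma> (a # xs @ [b]) \<inter> walk_image \<gamma> (a # ys @ [b])"
    using pos_in_walk[OF assms(2)] pos_in_walk[OF assms(3)] by auto
qed

text \<open>The half-open edge still contains its other end; being connected, it lies on the same
  side of a curve it avoids as that vertex.\<close>

lemma connected_edge_minus_end:
  assumes "E x y" shows "connected (path_image (\<gamma> x y) - {pos x})"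
proof -
  let ?g = "\<gamma> x y"
  have g: "continuous_on {0..1} ?g" "inj_on ?g {0..1}" "?g 0 = pos x"
    using edge_arc[OF assms] by (auto simp: arc_def path_def pathstart_def)
  have "?g ` {0..1} - ?g ` {0} = ?g ` ({0..1} - {0})"
    using g(2) by (subst inj_on_image_set_diff[of ?g "{0..1}"]) auto
  moreover have "{0..1} - {0} = {0<..1::real}" by auto
  ultimately have "path_image ?g - {pos x} = ?g ` {0<..1}"
    by (simp add: path_image_def g(3))
  moreover have "connected (?g ` {0<..1})"
    by (intro connected_continuous_image continuous_on_subset[OF g(1)]) auto
  ultimately show ?thesis by simp
qed

section \<open>Consequences of having all vertices on the outer face\<close>

context
  fixes F :: "complex set"
  assumes F: "F \<in> components (- drawing V E pos \<gamma>)" "\<not> bounded F" and outer: "\<forall>v\<in>V. pos v \<in> frontier F"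
begin

text \<open>The face \<open>F\<close> is connected, unbounded and misses \<open>C\<close>, so it is
  outside \<open>C\<close>. The inside is open, hence also misses the closure of \<open>F\<close>,
  which contains every vertex.\<close>

lemma vertex_not_inside:
  assumes C: "compact C" "C \<subseteq> drawing V E pos \<gamma>" and v: "v \<in> V"
  shows "pos v \<notin> inside C"
proof
  assume i: "pos v \<in> inside C"
  have "connected F" "F \<inter> C = {}"
    using in_components_connected[OF F(1)] in_components_subset[OF F(1)] C(2) by auto
  moreover have "\<not> F \<subseteq> inside C"
    using F(2) bounded_inside[OF compact_imp_bounded[OF C(1)]] bounded_subset by blast
  ultimately have "F \<subseteq> outside C" using connected_inside_or_outside by blast
  then have "inside C \<inter> F = {}" using inside_Int_outside by blast
  then have "inside C \<inter> closure F = {}"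
    using open_Int_closure_eq_empty[OF open_inside[OF compact_imp_closed[OF C(1)]]] by blast
  then show False using i outer v unfolding frontier_def by blast
qed

text \<open>One of the three arcs is enclosed by the other two, and it cannot have an inner vertex.
  This yields both that there is no theta with three long paths and that a chord of a cycle is drawn
  inside the cycle.\<close>

lemma theta_walks:
  assumes d: "distinct (a # b # xs @ ys @ zs)"
    and w: "successively E (a # xs @ [b])" "successively E (a # ys @ [b])" "successively E (a # zs @ [b])"
    and ne: "xs \<noteq> []" "ys \<noteq> []"
  shows "zs = [] \<and> walk_image \<gamma> (a # zs @ [b]) - {pos a, pos b} \<subseteq>
    inside (walk_image \<gamma> (a # xs @ [b]) \<union> walk_image \<gamma> (a # ys @ [b]))"
proof -
  let ?W = "\<lambda>xs. walk_image \<gamma> (a # xs @ [b])"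
  obtain g1 where g1: "arc g1" "pathstart g1 = pos a" "pathfinish g1 = pos b" "path_image g1 = ?W xs"
    using walk_arc[OF w(1)] d by auto
  obtain g2 where g2: "arc g2" "pathstart g2 = pos a" "pathfinish g2 = pos b" "path_image g2 = ?W ys"
    using walk_arc[OF w(2)] d by auto
  obtain g3 where g3: "arc g3" "pathstart g3 = pos a" "pathfinish g3 = pos b" "path_image g3 = ?W zs"
    using walk_arc[OF w(3)] d by auto
  have I: "?W xs \<inter> ?W ys = {pos a, pos b}" "?W xs \<inter> ?W zs = {pos a, pos b}" "?W ys \<inter> ?W zs = {pos a, pos b}"
    using d ne by (intro paths_Int w; auto)+
  have V: "set p \<subseteq> V" if "successively E (a # p @ [b])" for p
  proof
    fix x assume "x \<in> set p"
    then obtain r s where "p = r @ x # s" by (meson split_list)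
    then have "E x (hd (s @ [b]))" using that by (cases s) (auto simp: successively_append_iff successively_Cons)
    then show "x \<in> V" by (rule edge_vertices(1))
  qed
  have "a \<in> V" using edge_vertices(1) w(1) ne(1) by (cases xs) auto
  have "b \<in> V" using edge_vertices(2) w(1) by (auto simp: successively_append_iff successively_Cons)
  have not_in: "\<not> ?W p - {pos a, pos b} \<subseteq> inside (?W q \<union> ?W r)"
    if sp: "successively E (a # p @ [b])" "successively E (a # q @ [b])" "successively E (a # r @ [b])"
      and p: "p \<noteq> []" "distinct (a # b # p)" for p q r
  proof
    assume sub: "?W p - {pos a, pos b} \<subseteq> inside (?W q \<union> ?W r)"
    obtain x where x: "x \<in> set p" using p(1) by (cases p) auto
    then have "x \<in> V" "x \<noteq> a" "x \<noteq> b" using V[OF sp(1)] p(2) by auto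
    then have "pos x \<in> ?W p - {pos a, pos b}"
      using pos_in_walk[OF sp(1), of x] x pos_eq_iff \<open>a \<in> V\<close> \<open>b \<in> V\<close> by auto
    moreover have "compact (?W q \<union> ?W r)" "?W q \<union> ?W r \<subseteq> drawing V E pos \<gamma>"
      using compact_walk_image[OF sp(2)] compact_walk_image[OF sp(3)]
        walk_image_subset_drawing[OF sp(2)] walk_image_subset_drawing[OF sp(3)]
      by (auto intro: compact_Un)
    ultimately show False using vertex_not_inside[OF _ _ \<open>x \<in> V\<close>] sub by blast
  qed
  have "?W xs - {pos a, pos b} \<subseteq> inside (?W ys \<union> ?W zs) \<or> ?W ys - {pos a, pos b} \<subseteq> inside (?W xs \<union> ?W zs) \<or>
      ?W zs - {pos a, pos b} \<subseteq> inside (?W xs \<union> ?W ys)"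
    using theta_arc_inside[OF g1(1-3) g2(1-3) g3(1-3), unfolded g1(4) g2(4) g3(4), OF I] .
  moreover have "\<not> ?W xs - {pos a, pos b} \<subseteq> inside (?W ys \<union> ?W zs)"
    using d by (intro not_in w ne) auto
  moreover have "\<not> ?W ys - {pos a, pos b} \<subseteq> inside (?W xs \<union> ?W zs)"
    using d by (intro not_in w ne) auto
  moreover have "\<not> ?W zs - {pos a, pos b} \<subseteq> inside (?W xs \<union> ?W ys)" if "zs \<noteq> []"
    using d that by (intro not_in w) auto
  ultimately show ?thesis by blast
qed

text \<open>Both chords run inside the cycle, and the edge from \<open>a\<close> to \<open>b\<close>
  divides this inside into two regions. The edge from \<open>x\<close> to \<open>y\<close> without
  \<open>x\<close> avoids the boundary of the first region and contains the vertex \<open>y\<close>,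
  so it is outside that boundary; without \<open>y\<close> it is likewise outside the boundary of
  the second. No place remains for its inner points.\<close>

lemma crossing_chords:
  assumes d: "distinct (a # b # xs @ ys)"
    and w: "successively E (a # xs @ [b])" "successively E (a # ys @ [b])"
    and ab: "E a b" and x: "x \<in> set xs" and y: "y \<in> set ys" and xy: "E x y"
  shows False
proof -
  obtain x1 x2 where xs: "xs = x1 @ x # x2" using x by (meson split_list)
  obtain y1 y2 where ys: "ys = y1 @ y # y2" using y by (meson split_list)
  have ne: "xs \<noteq> []" "ys \<noteq> []" using xs ys by auto
  let ?P1 = "walk_image \<gamma> (a # xs @ [b])" and ?P2 = "walk_image \<gamma> (a # ys @ [b])"
    and ?P3 = "path_image (\<gamma> a b)" and ?R = "path_image (\<gamma> x y) - {pos x, pos y}"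
  have "symp E" using edge_vertices(4) by (auto intro: sympI)
  have rev: "successively E (rev p)" if "successively E p" for p
    using that successively_rev_sym[OF \<open>symp E\<close>] by blast
  have s: "successively E (a # x1 @ [x])" "successively E (x # x2 @ [b])"
    "successively E (a # y1 @ [y])" "successively E (y # y2 @ [b])"
    using w successively_append_iff[of E "a # x1" "x # x2 @ [b]"] successively_append_iff[of E "a # x1" "[x]"]
      successively_append_iff[of E "a # y1" "y # y2 @ [b]"] successively_append_iff[of E "a # y1" "[y]"]
    unfolding xs ys by auto
  have P: "?P1 = walk_image \<gamma> (a # x1 @ [x]) \<union> walk_image \<gamma> (x # x2 @ [b])"
    "?P2 = walk_image \<gamma> (a # y1 @ [y]) \<union> walk_image \<gamma> (y # y2 @ [b])"
    using walk_image_append[of \<gamma> "a # x1" x "x2 @ [b]"] walk_image_append[of \<gamma> "a # y1" y "y2 @ [b]"]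
    unfolding xs ys by auto
  \<comment> \<open>The same cycle is read as two paths from \<open>x\<close> to \<open>y\<close>,
    one through \<open>b\<close> and one through \<open>a\<close>, so that the edge between
    \<open>x\<close> and \<open>y\<close> becomes the third path of a theta.\<close>
  have Rin: "?R \<subseteq> inside (?P1 \<union> ?P2)"
  proof -
    let ?us = "x2 @ b # rev y2" and ?vs = "rev x1 @ a # y1"
    have r: "successively E (b # rev y2 @ [y])" "successively E (x # rev x1 @ [a])"
      using rev[OF s(4)] rev[OF s(1)] by auto
    have su: "successively E (x # ?us @ [y])"
      using s(2) r(1) successively_append_iff[of E "x # x2" "b # rev y2 @ [y]"]
        successively_append_iff[of E "x # x2" "[b]"] by auto
    have sv: "successively E (x # ?vs @ [y])"
      using s(3) r(2) successively_append_iff[of E "x # rev x1" "a # y1 @ [y]"]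
        successively_append_iff[of E "x # rev x1" "[a]"] by auto
    have "distinct (x # y # ?us @ ?vs @ [])" using d unfolding xs ys by auto
    from theta_walks[OF this su sv] xy
    have "?R \<subseteq> inside (walk_image \<gamma> (x # ?us @ [y]) \<union> walk_image \<gamma> (x # ?vs @ [y]))" by simp
    moreover have "walk_image \<gamma> (x # ?us @ [y]) = walk_image \<gamma> (x # x2 @ [b]) \<union> walk_image \<gamma> (y # y2 @ [b])"
      using walk_image_append[of \<gamma> "x # x2" b "rev y2 @ [y]"] walk_image_rev[OF s(4)] by auto
    moreover have "walk_image \<gamma> (x # ?vs @ [y]) = walk_image \<gamma> (a # x1 @ [x]) \<union> walk_image \<gamma> (a # y1 @ [y])"
      using walk_image_append[of \<gamma> "x # rev x1" a "y1 @ [y]"] walk_image_rev[OF s(1)] by auto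
    ultimately show ?thesis unfolding P by (simp add: Un_ac)
  qed
  have P3in: "?P3 - {pos a, pos b} \<subseteq> inside (?P1 \<union> ?P2)"
    using theta_walks[of a b xs ys "[]"] d w ab ne by auto
  have I: "?P1 \<inter> ?P2 = {pos a, pos b}" "?P1 \<inter> ?P3 = {pos a, pos b}" "?P2 \<inter> ?P3 = {pos a, pos b}"
    using paths_Int[OF d w] paths_Int[of a b xs "[]"] paths_Int[of a b ys "[]"] d w ab ne by auto
  have ends: "pos a \<noteq> pos b" using pos_eq_iff edge_vertices[OF ab] by blast
  have P3ne: "?P3 - {pos a, pos b} \<noteq> {}"
    using arc_endless_nonempty[OF edge_arc(1)[OF ab]] edge_arc[OF ab] by simp
  obtain g1 where g1: "arc g1" "pathstart g1 = pos a" "pathfinish g1 = pos b" "path_image g1 = ?P1"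
    using walk_arc[OF w(1)] d by auto
  obtain g2 where g2: "arc g2" "pathstart g2 = pos a" "pathfinish g2 = pos b" "path_image g2 = ?P2"
    using walk_arc[OF w(2)] d by auto
  note g3 = edge_arc[OF ab]
  have split: "inside (?P1 \<union> ?P3) \<union> inside (?P2 \<union> ?P3) \<union> (?P3 - {pos a, pos b}) = inside (?P1 \<union> ?P2)"
  proof -
    have "path_image (\<gamma> a b) \<inter> inside (path_image g1 \<union> path_image g2) \<noteq> {}"
      using P3in P3ne unfolding g1(4) g2(4) by blast
    from split_inside_simple_closed_curve[OF arc_imp_simple_path[OF g1(1)] g1(2,3)
        arc_imp_simple_path[OF g2(1)] g2(2,3) arc_imp_simple_path[OF g3(1)] g3(2,3) ends _ _ _ this]
    show ?thesis unfolding g1(4) g2(4) using I by blast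
  qed
  have dV: "x \<in> V" "y \<in> V" using edge_vertices[OF xy] by auto
  have dxy: "{x, y} \<inter> {a, b} = {}" "y \<notin> set (a # xs @ [b])" "x \<notin> set (a # ys @ [b])"
    using d x y by auto
  have R3: "path_image (\<gamma> x y) \<inter> ?P3 = {}"
    using edges_Int[OF xy ab] dxy(1) by (metis empty_iff image_empty insert_iff insert_not_empty inf.idem subset_empty)
  have out: "path_image (\<gamma> u v) - {pos u} \<subseteq> outside (P \<union> ?P3)"
    if uv: "E u v" and "P \<inter> path_image (\<gamma> u v) \<subseteq> {pos u}" "path_image (\<gamma> u v) \<inter> ?P3 = {}"
      and P: "compact P" "P \<subseteq> drawing V E pos \<gamma>" for u v P
  proof -
    have "compact (P \<union> ?P3)" "P \<union> ?P3 \<subseteq> drawing V E pos \<gamma>"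
      using P compact_arc_image[OF edge_arc(1)[OF ab]] walk_image_subset_drawing[of "[a, b]"] ab
      by (auto intro: compact_Un)
    then have "pos v \<notin> inside (P \<union> ?P3)" using vertex_not_inside edge_vertices(2)[OF uv] by blast
    moreover have "pos v \<in> path_image (\<gamma> u v) - {pos u}"
      using pos_in_edge(2)[OF uv] pos_eq_iff edge_vertices[OF uv] by auto
    moreover have "(path_image (\<gamma> u v) - {pos u}) \<inter> (P \<union> ?P3) = {}" using that(2,3) by blast
    ultimately show ?thesis
      using connected_inside_or_outside[OF connected_edge_minus_end[OF uv]] by blast
  qed
  have "?P1 \<inter> path_image (\<gamma> x y) \<subseteq> pos ` (set (a # xs @ [b]) \<inter> {x, y})"
    using dxy by (intro walk_edge_Int w xy) auto
  then have "?P1 \<inter> path_image (\<gamma> x y) \<subseteq> {pos x}" using dxy by auto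
  then have o1: "path_image (\<gamma> x y) - {pos x} \<subseteq> outside (?P1 \<union> ?P3)"
    using R3 by (intro out xy compact_walk_image walk_image_subset_drawing w)
  note yx = edge_vertices(4)[OF xy]
  have "?P2 \<inter> path_image (\<gamma> y x) \<subseteq> pos ` (set (a # ys @ [b]) \<inter> {y, x})"
    using dxy by (intro walk_edge_Int w yx) auto
  then have "?P2 \<inter> path_image (\<gamma> y x) \<subseteq> {pos y}" using dxy by auto
  then have "path_image (\<gamma> y x) - {pos y} \<subseteq> outside (?P2 \<union> ?P3)"
    using R3 edge_arc(4)[OF xy] by (intro out yx compact_walk_image walk_image_subset_drawing w) auto
  then have o2: "path_image (\<gamma> x y) - {pos y} \<subseteq> outside (?P2 \<union> ?P3)"
    using edge_arc(4)[OF xy] by simp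
  have "?R \<noteq> {}"
    using arc_endless_nonempty[OF edge_arc(1)[OF xy]] edge_arc[OF xy] by simp
  then obtain z where z: "z \<in> ?R" by blast
  then have "z \<in> inside (?P1 \<union> ?P3) \<or> z \<in> inside (?P2 \<union> ?P3) \<or> z \<in> ?P3" using Rin split by blast
  then show False
    using z o1 o2 R3 inside_Int_outside[of "?P1 \<union> ?P3"] inside_Int_outside[of "?P2 \<union> ?P3"] by blast
qed

end

end

section \<open>Intersection supports\<close>

lemma outerplanar_imp_noncrossing_on:
  assumes graph: "simple_graph V E" and "outerplanar V E"
  obtains f where "inj_on f V" "noncrossing_on E f V"
proof (cases "V = {}")
  case True
  then show ?thesis using that[of "\<lambda>_. 0"] by (simp add: noncrossing_on_def)
next
  case False
  then obtain v where "v \<in> V" by blast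
  obtain pos \<gamma> F where plane: "plane_embedding V E pos \<gamma>"
    and F: "F \<in> components (- drawing V E pos \<gamma>)" "\<not> bounded F" "\<forall>v\<in>V. pos v \<in> frontier F"
    using assms(2) unfolding outerplanar_def by blast
  have "finite V" "symp E" "irreflp E"
    using graph unfolding simple_graph_def symp_def irreflp_def by auto
  then have "\<exists>f. inj_on f V \<and> f v = 0 \<and> noncrossing_on E f V"
  proof (rule exists_noncrossing_on[OF _ \<open>v \<in> V\<close>], goal_cases)
    case (1 a b xs ys zs)
    then show False using theta_walks[OF plane graph F] by blast
  next
    case (2 a b xs ys x y)
    then show False using crossing_chords[OF plane graph F] by blast
  qed
  then show ?thesis using that by blast
qed

text \<open>Some edge of \<open>T\<close> leaves the gap of \<open>S\<close> in which it starts, so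
  it has points of \<open>S\<close> both under it and not under it. By connectedness an edge of
  \<open>S\<close> passes from one kind to the other, and this edge crosses it.\<close>

lemma noncrossing_on_imp_not_abab:
  assumes nc: "noncrossing_on E f V" and inj: "inj_on f V" and sym: "symp E"
    and S: "connected_on E S" "S \<subseteq> V" and T: "connected_on E T" "T \<subseteq> V" and ST: "S \<inter> T = {}"
  shows "\<not> abab (f ` S) (f ` T)"
proof
  assume "abab (f ` S) (f ` T)"
  then obtain a b c d where abcd: "a \<in> S" "b \<in> T" "c \<in> S" "d \<in> T" "f a < f b" "f b < f c" "f c < f d"
    unfolding abab_def by blast
  let ?P = "\<lambda>x. \<forall>s\<in>S. f s < f b \<longleftrightarrow> f s < f x"
  \<comment> \<open>An edge of T leaving the gap of S that contains b has vertices of S on both of its sides.\<close>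
  have "?P b" "\<not> ?P d" using abcd by force+
  from connected_on_crossing_edge[OF T(1) abcd(2) this(1) abcd(4) this(2)]
  obtain u v where uv: "u \<in> T" "v \<in> T" "E u v" "?P u" "\<not> ?P v" by blast
  have neq: "f s \<noteq> f t" if "s \<in> S" "t \<in> T" for s t
    using that inj_onD[OF inj, of s t] S(2) T(2) ST by blast
  have bounds: "f a < f u" "f u < f c"
    using uv(4) abcd neq[OF abcd(3) uv(1)] by (metis, metis linorder_neqE_nat less_asym)
  obtain s where s: "s \<in> S" "(f s < f u) \<noteq> (f s < f v)" using uv(4,5) by blast
  define lo where "lo = min (f u) (f v)"
  define hi where "hi = max (f u) (f v)"
  have "\<exists>s\<in>S. lo < f s \<and> f s < hi"
    using s neq[OF s(1) uv(1)] neq[OF s(1) uv(2)] unfolding lo_def hi_def by (intro bexI[of _ s]) auto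
  \<comment> \<open>Since \<open>u\<close> lies between \<open>a\<close> and \<open>c\<close>, the
    point \<open>a\<close> is below the edge if \<open>u\<close> is its lower end, and
    \<open>c\<close> is above it if \<open>u\<close> is its upper end.\<close>
  moreover have "\<exists>s\<in>S. \<not> (lo < f s \<and> f s < hi)"
  proof (cases "f u < f v")
    case True
    then show ?thesis using bounds(1) abcd(1) unfolding lo_def by (intro bexI[of _ a]) auto
  next
    case False
    then show ?thesis using bounds(2) abcd(3) unfolding hi_def by (intro bexI[of _ c]) auto
  qed
  ultimately obtain x y where x: "x \<in> S" "lo < f x \<and> f x < hi" and y: "y \<in> S" "\<not> (lo < f y \<and> f y < hi)"
    by blast
  obtain x y where xy: "x \<in> S" "y \<in> S" "E x y" "lo < f x \<and> f x < hi" "\<not> (lo < f y \<and> f y < hi)"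
    by (rule connected_on_crossing_edge[OF S(1) x y]) blast
  have ne: "f y \<noteq> lo" "f y \<noteq> hi"
    using neq[OF xy(2) uv(1)] neq[OF xy(2) uv(2)] unfolding lo_def hi_def by (auto simp: min_def max_def)
  have E: "E y x" "E v u" using xy uv sym by (auto dest: sympD)
  have V: "x \<in> V" "y \<in> V" "u \<in> V" "v \<in> V" using xy uv S(2) T(2) by auto
  have cr: "False" if "p \<in> V" "q \<in> V" "E p q" "f p = lo" "f q = hi" for p q
  proof (cases "f y < lo")
    case True
    then show False using nc that V xy E(1) unfolding noncrossing_on_def by metis
  next
    case False
    then have "hi < f y" using ne xy(5) by auto
    then show False using nc that V xy unfolding noncrossing_on_def by metis
  qed
  show False
  proof (cases "f u < f v")
    case True
    then have "f u = lo" "f v = hi" unfolding lo_def hi_def by auto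
    then show False by (rule cr[OF V(3,4) uv(3)])
  next
    case False
    then have "f v = lo" "f u = hi" unfolding lo_def hi_def by auto
    then show False by (rule cr[OF V(4,3) E(2)])
  qed
qed

theorem mainTheorem6:
  fixes V :: "'a set" and E :: "'a \<Rightarrow> 'a \<Rightarrow> bool" and \<H> \<K> :: "'a set set"
  assumes "simple_graph V E" and "outerplanar V E"
    and "non_piercing V E \<H>" and "non_piercing V E \<K>"
  shows "\<exists>Q. intersection_support \<H> \<K> Q \<and> outerplanar \<H> Q"
proof -
  obtain p where p: "inj_on p V" "noncrossing_on E p V"
    by (rule outerplanar_imp_noncrossing_on[OF assms(1,2)])
  have "finite V" "symp E" using assms(1) unfolding simple_graph_def symp_def by auto
  have non: "noninterleaving (p ` S) (p ` T)"
    if "connected_on E S" "S \<subseteq> V" "connected_on E T" "T \<subseteq> V" "S \<inter> T = {}" for S T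
    unfolding noninterleaving_def
    using noncrossing_on_imp_not_abab[OF p(2,1) \<open>symp E\<close>] that by (simp add: Int_commute)
  have sub: "A \<subseteq> V" "connected_on E A" "connected_on E (A - B)"
    if "non_piercing V E \<A>" "A \<in> \<A>" "B \<in> \<A>" for \<A> A B
    using that unfolding non_piercing_def by auto
  \<comment> \<open>This is where non-piercing enters: \<open>A'\<close> and \<open>B' - A'\<close>
    are disjoint connected vertex sets.\<close>
  have family: "noninterleaving A (B - A)"
    if np: "non_piercing V E \<A>" and AB: "A \<in> (`) p ` \<A>" "B \<in> (`) p ` \<A>" for \<A> A B
  proof -
    obtain A' B' where A: "A' \<in> \<A>" "A = p ` A'" and B: "B' \<in> \<A>" "B = p ` B'" using AB by blast
    have "B - A = p ` (B' - A')"
      using inj_on_image_set_diff[OF p(1), of B' A'] sub(1)[OF np] A B by auto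
    moreover have "noninterleaving (p ` A') (p ` (B' - A'))"
      using sub[OF np A(1) B(1)] sub[OF np B(1) A(1)] by (intro non) auto
    ultimately show ?thesis using A by simp
  qed
  have "\<H> \<subseteq> Pow V" using assms(3) unfolding non_piercing_def by auto
  then have finH: "finite \<H>" and injH: "inj_on ((`) p) \<H>"
    using \<open>finite V\<close> finite_subset inj_on_subset[OF inj_on_image_Pow[OF p(1)]] by auto
  have meet: "p ` H \<inter> p ` K \<noteq> {} \<longleftrightarrow> H \<inter> K \<noteq> {}" if "H \<in> \<H>" "K \<in> \<K>" for H K
    using inj_on_image_Int[OF p(1), of H K] sub(1)[OF assms(3)] sub(1)[OF assms(4)] that
    by (metis image_is_empty)
  obtain r T where r: "inj_on r ((`) p ` \<H>)" and T: "symp T" "irreflp T" "noncrossing T"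
    and conn: "\<And>K. K \<in> (`) p ` \<K> \<Longrightarrow> connected_on T (r ` {H \<in> (`) p ` \<H>. H \<inter> K \<noteq> {}})"
  proof (rule noncrossing_intersection_support_nat[of "(`) p ` \<H>" "(`) p ` \<K>"])
    show "finite ((`) p ` \<H>)" using finH by simp
    fix r and T :: "nat \<Rightarrow> nat \<Rightarrow> bool"
    assume "inj_on r ((`) p ` \<H>)" "symp T" "irreflp T" "noncrossing T"
      "\<And>K. K \<in> (`) p ` \<K> \<Longrightarrow> connected_on T (r ` {H \<in> (`) p ` \<H>. H \<inter> K \<noteq> {}})"
    then show thesis by (rule that)
  next
    show "finite H" if "H \<in> (`) p ` \<H>" for H
      using that \<open>\<H> \<subseteq> Pow V\<close> \<open>finite V\<close> by (auto intro: finite_subset)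
    show "noninterleaving H K" if HK: "H \<in> (`) p ` \<H>" "K \<in> (`) p ` \<K>" "H \<inter> K = {}" for H K
    proof -
      obtain H' K' where H: "H' \<in> \<H>" "H = p ` H'" and K: "K' \<in> \<K>" "K = p ` K'" using HK(1,2) by blast
      have "H' \<inter> K' = {}" using meet[OF H(1) K(1)] HK(3) H K by simp
      then show ?thesis
        using sub(1,2)[OF assms(3) H(1) H(1)] sub(1,2)[OF assms(4) K(1) K(1)] H K by (simp add: non)
    qed
  qed (rule family[OF assms(3)] family[OF assms(4)]; assumption)+
  define f where "f H = r (p ` H)" for H
  have f: "inj_on f \<H>"
    unfolding f_def using comp_inj_on[OF injH r] by (simp add: o_def)
  define Q where "Q H H' \<longleftrightarrow> H \<in> \<H> \<and> H' \<in> \<H> \<and> T (f H) (f H')" for H H'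
  have Q: "simple_graph \<H> Q"
    using finH T(1,2) unfolding simple_graph_def Q_def by (auto dest: sympD irreflpD)
  have "connected_on Q {H \<in> \<H>. H \<inter> K \<noteq> {}}" if "K \<in> \<K>" for K
  proof -
    let ?S = "{H \<in> \<H>. H \<inter> K \<noteq> {}}"
    have "{H \<in> (`) p ` \<H>. H \<inter> p ` K \<noteq> {}} = (`) p ` {H \<in> \<H>. p ` H \<inter> p ` K \<noteq> {}}" by auto
    also have "{H \<in> \<H>. p ` H \<inter> p ` K \<noteq> {}} = ?S" by (rule Collect_cong) (use meet that in blast)
    finally have "{H \<in> (`) p ` \<H>. H \<inter> p ` K \<noteq> {}} = (`) p ` ?S" .
    then have c: "connected_on T (f ` ?S)"
      using conn[of "p ` K"] that unfolding f_def by (simp add: image_image)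
    show ?thesis
      unfolding connected_on_def
    proof (intro ballI)
      fix A B assume AB: "A \<in> ?S" "B \<in> ?S"
      let ?R = "\<lambda>u v. u \<in> ?S \<and> v \<in> ?S \<and> Q u v"
      have "(\<lambda>u v. u \<in> f ` ?S \<and> v \<in> f ` ?S \<and> T u v)\<^sup>*\<^sup>* (f A) (f B)"
        using c AB unfolding connected_on_def by blast
      \<comment> \<open>A walk of \<open>T\<close> within the image of \<open>?S\<close> lifts step
        by step to \<open>Q\<close>; injectivity of \<open>f\<close> then identifies the end of the
        lifted walk with \<open>B\<close>.\<close>
      then have "\<exists>C\<in>?S. f C = f B \<and> ?R\<^sup>*\<^sup>* A C"
      proof (induction rule: rtranclp_induct)
        case base
        then show ?case using AB by blast
      next
        case (step y z)
        then obtain C D where C: "C \<in> ?S" "f C = y" "?R\<^sup>*\<^sup>* A C" and D: "D \<in> ?S" "z = f D" by blast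
        then have "?R C D" using step.hyps unfolding Q_def by auto
        with C D show ?case by (intro bexI[of _ D]) (auto intro: rtranclp.rtrancl_into_rtrancl)
      qed
      then show "?R\<^sup>*\<^sup>* A B" using f AB by (auto dest: inj_onD)
    qed
  qed
  moreover have "outerplanar \<H> Q"
    by (rule noncrossing_imp_outerplanar[OF f Q T]) (simp add: Q_def)
  ultimately show ?thesis using Q unfolding intersection_support_def by blast
qed

end
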